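(* For each countable scattered linear order $L$, the pre-order $\langle\mathbb P(L),\le\rangle$ is $\sigma$-closed, where $\mathbb P(L)=\{A\subseteq L:A\cong L\}$ and $\le$ is the separative modification of $\subseteq$ on $\mathbb P(L)$.
   Context: A linear order is scattered if $\mathbb Q$ does not embed into it. The separative modification of $\langle\mathbb P(L),\subseteq\rangle$ is the pre-order given by $A\le B$ iff for every $C\in\mathbb P(L)$ with $C\subseteq A$ there is $D\in\mathbb P(L)$ with $D\subseteq C\cap B$. A pre-order is $\sigma$-closed if every sequence $p_0\ge p_1\ge p_2\ge\cdots$ has a lower bound. *)

theory Defs
  imports Complex_Main "HOL-Library.Countable_Set"
begin

(* A linear order is a carrier set L together with its non-strict order relation r, that is
   linear_order_on L r.  In particular r is contained in L \<times> L, so Field r = L. *)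

definition scattered_on :: "'a set \<Rightarrow> 'a rel \<Rightarrow> bool" where
  "scattered_on L r \<longleftrightarrow>
     \<not> (\<exists>f :: rat \<Rightarrow> 'a. range f \<subseteq> L \<and> (\<forall>x y. x \<le> y \<longleftrightarrow> (f x, f y) \<in> r))"

(* The library constant iso comes from the theory of well-orders, but by iso_iff2 it is the usual
   notion of isomorphism for arbitrary relations: a bijection of the fields that preserves and
   reflects the relation. *)

definition copies :: "'a set \<Rightarrow> 'a rel \<Rightarrow> 'a set set" where
  "copies L r = {A. A \<subseteq> L \<and> (\<exists>f. iso (Restr r A) r f)}"

definition sep_mod :: "'a set \<Rightarrow> 'a rel \<Rightarrow> 'a set rel" where
  "sep_mod L r = {(A, B). A \<in> copies L r \<and> B \<in> copies L r \<and>
     (\<forall>C \<in> copies L r. C \<subseteq> A \<longrightarrow> (\<exists>D \<in> copies L r. D \<subseteq> C \<inter> B))}"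

(* A pair (p, q) in R is read as p \<le> q. *)

definition sigma_closed_on :: "'b set \<Rightarrow> 'b rel \<Rightarrow> bool" where
  "sigma_closed_on P R \<longleftrightarrow>
     (\<forall>p :: nat \<Rightarrow> 'b. (\<forall>n. p n \<in> P) \<longrightarrow> (\<forall>n. (p (Suc n), p n) \<in> R) \<longrightarrow>
        (\<exists>q \<in> P. \<forall>n. (q, p n) \<in> R))"

lemma preorder_on_sep_mod: "preorder_on (copies L r) (sep_mod L r)"
proof -
  have "trans (sep_mod L r)"
  proof (rule transI)
    fix A B E
    assume AB: "(A, B) \<in> sep_mod L r" and BE: "(B, E) \<in> sep_mod L r"
    have "\<exists>D \<in> copies L r. D \<subseteq> C \<inter> E" if C: "C \<in> copies L r" "C \<subseteq> A" for C
    proof -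
      from AB C have "\<exists>D \<in> copies L r. D \<subseteq> C \<inter> B"
        by (simp add: sep_mod_def)
      then obtain D where D: "D \<in> copies L r" "D \<subseteq> C" "D \<subseteq> B"
        by auto
      with BE have "\<exists>D' \<in> copies L r. D' \<subseteq> D \<inter> E"
        by (simp add: sep_mod_def)
      then obtain D' where "D' \<in> copies L r" "D' \<subseteq> C \<inter> E"
        using D(2) by auto
      then show ?thesis ..
    qed
    with AB BE show "(A, E) \<in> sep_mod L r"
      by (simp add: sep_mod_def)
  qed
  moreover have "refl_on (copies L r) (sep_mod L r)"
    by (auto simp: refl_on_def sep_mod_def)
  moreover have "sep_mod L r \<subseteq> copies L r \<times> copies L r"
    by (auto simp: sep_mod_def)
  ultimately show ?thesis
    by (simp add: preorder_on_def)
qed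

end

theory Submission
  imports Defs
begin

text \<open>By a theorem of Laver, a countable scattered order \<open>L\<close> is a finite sum of hereditarily indecomposable
  orders, each of them a point or an \<open>\<omega>\<close>- or \<open>\<omega>\<close>*-sum of smaller ones in which every summand embeds into
  infinitely many others. Hausdorff's condensation reduces this to the fact that such orders are
  well-quasi-ordered by embeddability. A bad sequence of them would yield, by descending into the summands, a
  finite colouring of the increasing sequences of natural numbers in which a sequence and its shift never agree;
  the colouring is a limit of continuous ones, hence constant on the branches of a tree that branches along
  an ultrafilter, a contradiction.

  In a decomposition of minimal length every self-embedding of \<open>L\<close> maps a cofinal part of each block into that
  block. Hence a subset of \<open>L\<close> contains a copy of \<open>L\<close> iff its trace on each block contains a copy of the block,
  and inside a single \<open>\<omega>\<close>-sum the copies can be diagonalised like infinite subsets of \<open>\<omega>\<close>.\<close>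

section \<open>Ramsey theory along a free ultrafilter\<close>

locale free_ultrafilter =
  fixes U :: "nat filter"
  assumes proper: "U \<noteq> bot"
    and free: "U \<le> sequentially"
    and dichotomy: "eventually P U \<or> eventually (\<lambda>x. \<not> P x) U"

lemma ex_free_ultrafilter: "\<exists>U. free_ultrafilter U"
proof -
  define A where "A = {G :: nat filter. G \<noteq> bot \<and> G \<le> sequentially}"
  have "\<exists>m\<in>A. \<forall>a\<in>A. m \<ge> a \<longrightarrow> a = m"
  proof (rule predicate_Zorn)
    show "partial_order_on A (relation_of (\<ge>) A)"
      by (rule partial_order_on_relation_ofI) auto
    fix C assume C: "C \<in> Chains (relation_of (\<ge>) A)"
    show "\<exists>u\<in>A. \<forall>a\<in>C. a \<ge> u"
    proof (cases "C = {}")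
      case True
      then show ?thesis by (auto simp: A_def intro!: exI[of _ sequentially])
    next
      case False
      from C have CA: "C \<subseteq> A" and lin: "\<And>F G. F \<in> C \<Longrightarrow> G \<in> C \<Longrightarrow> F \<le> G \<or> G \<le> F"
        by (auto simp: Chains_def relation_of_def)
      have "eventually P (Inf C) \<longleftrightarrow> (\<exists>G\<in>C. eventually P G)" for P
        by (rule eventually_Inf_base[OF False]) (use lin in \<open>force\<close>)
      then have "Inf C \<noteq> bot"
        using CA by (auto simp: trivial_limit_def A_def)
      moreover obtain G where "G \<in> C" using False by blast
      ultimately have "Inf C \<in> A"
        using CA by (auto simp: A_def intro: Inf_lower2)
      then show ?thesis by (auto intro: Inf_lower)
    qed
  qed
  then obtain U where U: "U \<noteq> bot" "U \<le> sequentially"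
    and max: "\<And>G. G \<noteq> bot \<Longrightarrow> G \<le> sequentially \<Longrightarrow> G \<le> U \<Longrightarrow> G = U"
    by (auto simp: A_def)
  have "eventually P U" if "\<not> eventually (\<lambda>x. \<not> P x) U" for P
  proof -
    let ?G = "inf U (principal {x. P x})"
    have "?G \<noteq> bot"
      using that by (simp add: trivial_limit_def eventually_inf_principal)
    then have "?G = U" using U(2) by (intro max) (auto intro: le_infI1)
    moreover have "eventually P ?G" by (simp add: eventually_inf_principal)
    ultimately show ?thesis by simp
  qed
  with U have "free_ultrafilter U" by unfold_locales auto
  then show ?thesis ..
qed

definition prefix_of :: "(nat \<Rightarrow> nat) \<Rightarrow> nat \<Rightarrow> nat list" where
  "prefix_of x n = map x [0..<n]"

lemma length_prefix_of [simp]: "length (prefix_of x n) = n"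
  by (simp add: prefix_of_def)

lemma prefix_of_Suc: "prefix_of x (Suc n) = prefix_of x n @ [x n]"
  by (simp add: prefix_of_def)

lemma nth_prefix_of [simp]: "i < n \<Longrightarrow> prefix_of x n ! i = x i"
  by (simp add: prefix_of_def)

lemma take_prefix_of [simp]: "m \<le> n \<Longrightarrow> take m (prefix_of x n) = prefix_of x m"
  by (simp add: prefix_of_def take_map)

context free_ultrafilter
begin

text \<open>A tree of finite sequences is given by the sets \<open>\<sigma> t\<close> of admissible next entries. Thus \<open>forces s S\<close>
  says that all branches of some \<open>U\<close>-branching tree with stem \<open>s\<close> lie in \<open>S\<close>.\<close>

definition branch :: "(nat list \<Rightarrow> nat \<Rightarrow> bool) \<Rightarrow> nat list \<Rightarrow> (nat \<Rightarrow> nat) \<Rightarrow> bool" where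
  "branch \<sigma> s x \<longleftrightarrow> prefix_of x (length s) = s \<and> (\<forall>n\<ge>length s. \<sigma> (prefix_of x n) (x n))"

definition forces :: "nat list \<Rightarrow> ((nat \<Rightarrow> nat) \<Rightarrow> bool) \<Rightarrow> bool" where
  "forces s S \<longleftrightarrow> (\<exists>\<sigma>. (\<forall>t. eventually (\<sigma> t) U) \<and> (\<forall>x. branch \<sigma> s x \<longrightarrow> S x))"

definition decided :: "((nat \<Rightarrow> nat) \<Rightarrow> bool) \<Rightarrow> bool" where
  "decided S \<longleftrightarrow> (\<forall>s. forces s S \<or> forces s (\<lambda>x. \<not> S x))"

lemma forces_mono: "forces s S \<Longrightarrow> (\<And>x. S x \<Longrightarrow> S' x) \<Longrightarrow> forces s S'"
  unfolding forces_def by blast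

lemma forces_conj:
  assumes "forces s S" "forces s S'"
  shows "forces s (\<lambda>x. S x \<and> S' x)"
proof -
  obtain \<sigma> \<sigma>' where "\<forall>t. eventually (\<sigma> t) U" "\<forall>x. branch \<sigma> s x \<longrightarrow> S x"
    "\<forall>t. eventually (\<sigma>' t) U" "\<forall>x. branch \<sigma>' s x \<longrightarrow> S' x"
    using assms unfolding forces_def by blast
  then show ?thesis unfolding forces_def
    by (intro exI[of _ "\<lambda>t a. \<sigma> t a \<and> \<sigma>' t a"]) (auto simp: branch_def eventually_conj_iff)
qed

lemma forces_glue:
  assumes "eventually (\<lambda>a. forces (s @ [a]) S) U"
  shows "forces s S"
proof -
  have "\<exists>\<sigma>. forces (s @ [a]) S \<longrightarrow> (\<forall>t. eventually (\<sigma> t) U) \<and> (\<forall>x. branch \<sigma> (s @ [a]) x \<longrightarrow> S x)" for a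
    unfolding forces_def by blast
  then obtain \<sigma> where \<sigma>: "\<And>a. forces (s @ [a]) S \<Longrightarrow> (\<forall>t. eventually (\<sigma> a t) U)"
      "\<And>a x. forces (s @ [a]) S \<Longrightarrow> branch (\<sigma> a) (s @ [a]) x \<Longrightarrow> S x"
    by metis
  define \<tau> where "\<tau> t b \<longleftrightarrow> (t = s \<longrightarrow> forces (s @ [b]) S) \<and>
     (length s < length t \<and> forces (s @ [t ! length s]) S \<longrightarrow> \<sigma> (t ! length s) t b)" for t b
  have "eventually (\<tau> t) U" for t
    unfolding \<tau>_def using assms \<sigma>(1)
    by (intro eventually_conj; cases "t = s"; cases "length s < length t \<and> forces (s @ [t ! length s]) S") auto
  moreover have "S x" if x: "branch \<tau> s x" for x
  proof -
    let ?n = "length s"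
    have s: "prefix_of x ?n = s" and \<tau>: "\<And>n. n \<ge> ?n \<Longrightarrow> \<tau> (prefix_of x n) (x n)"
      using x by (auto simp: branch_def)
    have f: "forces (s @ [x ?n]) S" using \<tau>[of ?n] s by (simp add: \<tau>_def)
    moreover have "branch (\<sigma> (x ?n)) (s @ [x ?n]) x"
      unfolding branch_def using s \<tau> f by (auto simp: prefix_of_Suc \<tau>_def)
    ultimately show ?thesis by (rule \<sigma>(2))
  qed
  ultimately show ?thesis unfolding forces_def by blast
qed

lemma decided_not: "decided S \<Longrightarrow> decided (\<lambda>x. \<not> S x)"
  unfolding decided_def by auto

lemma decided_of_prefix:
  assumes "\<And>x y. prefix_of x k = prefix_of y k \<Longrightarrow> S x = S y"
  shows "decided S"
  unfolding decided_def
proof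
  fix s
  show "forces s S \<or> forces s (\<lambda>x. \<not> S x)"
  proof (induction "k - length s" arbitrary: s)
    case 0
    have "S x = S y" if "branch (\<lambda>_ _. True) s x" "branch (\<lambda>_ _. True) s y" for x y
    proof (rule assms)
      have "prefix_of x (length s) = prefix_of y (length s)" using that by (auto simp: branch_def)
      then have "take k (prefix_of x (length s)) = take k (prefix_of y (length s))" by simp
      then show "prefix_of x k = prefix_of y k" using 0 by simp
    qed
    then have "(\<forall>x. branch (\<lambda>_ _. True) s x \<longrightarrow> S x) \<or> (\<forall>x. branch (\<lambda>_ _. True) s x \<longrightarrow> \<not> S x)"
      by blast
    then show ?case unfolding forces_def
      by (metis eventually_True)
  next
    case (Suc n)
    then have "forces (s @ [a]) S \<or> forces (s @ [a]) (\<lambda>x. \<not> S x)" for a by simp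
    then have "eventually (\<lambda>a. forces (s @ [a]) S) U \<or> eventually (\<lambda>a. forces (s @ [a]) (\<lambda>x. \<not> S x)) U"
      using dichotomy[of "\<lambda>a. forces (s @ [a]) S"]
        eventually_mono[of "\<lambda>a. \<not> forces (s @ [a]) S" U "\<lambda>a. forces (s @ [a]) (\<lambda>x. \<not> S x)"] by blast
    then show ?case using forces_glue by blast
  qed
qed

text \<open>Fusion: if \<open>s\<close> does not force the union, then neither do almost all of its successors,
  and from level \<open>n\<close> on the tree of these nodes can be thinned so as to avoid the sets up to the \<open>n\<close>-th.\<close>

lemma decided_ex:
  assumes "\<And>n :: nat. decided (S n)"
  shows "decided (\<lambda>x. \<exists>n. S n x)"
  unfolding decided_def
proof (intro allI, rule disjCI[THEN disj_commute[THEN iffD1]])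
  fix s assume s: "\<not> forces s (\<lambda>x. \<exists>n. S n x)"
  define bad where "bad t \<longleftrightarrow> \<not> forces t (\<lambda>x. \<exists>n. S n x)" for t
  have bad_ev: "eventually (\<lambda>a. bad (t @ [a])) U" if "bad t" for t
  proof (rule ccontr)
    assume "\<not> eventually (\<lambda>a. bad (t @ [a])) U"
    then have "eventually (\<lambda>a. forces (t @ [a]) (\<lambda>x. \<exists>n. S n x)) U"
      using dichotomy[of "\<lambda>a. bad (t @ [a])"] by (simp add: bad_def)
    then show False using forces_glue that unfolding bad_def by blast
  qed
  have "forces t (\<lambda>x. \<not> S n x)" if "bad t" for t n
  proof -
    have "\<not> forces t (S n)" using that forces_mono[of t "S n" "\<lambda>x. \<exists>n. S n x"] by (auto simp: bad_def)
    then show ?thesis using assms[of n] by (auto simp: decided_def)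
  qed
  then have "\<exists>\<sigma>. bad t \<longrightarrow> (\<forall>u. eventually (\<sigma> u) U) \<and> (\<forall>x. branch \<sigma> t x \<longrightarrow> \<not> S n x)" for t n
    by (simp add: forces_def)
  then obtain \<sigma> where \<sigma>: "\<And>t n u. bad t \<Longrightarrow> eventually (\<sigma> t n u) U"
      "\<And>t n x. bad t \<Longrightarrow> branch (\<sigma> t n) t x \<Longrightarrow> \<not> S n x"
    by metis
  define \<tau> where "\<tau> t a \<longleftrightarrow> (bad t \<longrightarrow> bad (t @ [a])) \<and>
    (\<forall>i\<in>{..length t}. \<forall>n\<in>{..i}. bad (take i t) \<longrightarrow> \<sigma> (take i t) n t a)" for t a
  have "eventually (\<tau> t) U" for t
    unfolding \<tau>_def
  proof (intro eventually_conj eventually_ball_finite ballI)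
    show "\<forall>\<^sub>F a in U. bad t \<longrightarrow> bad (t @ [a])"
      by (cases "bad t") (use bad_ev in auto)
    show "\<forall>\<^sub>F a in U. bad (take i t) \<longrightarrow> \<sigma> (take i t) n t a" for i n
      by (cases "bad (take i t)") (use \<sigma>(1) in auto)
  qed auto
  moreover have "\<not> S n x" if x: "branch \<tau> s x" for x n
  proof -
    have \<tau>: "\<tau> (prefix_of x m) (x m)" if "m \<ge> length s" for m
      using x that by (auto simp: branch_def)
    have bad: "bad (prefix_of x m)" if "m \<ge> length s" for m
      using that
    proof (induction m rule: dec_induct)
      case base
      then show ?case using x s by (simp add: branch_def bad_def)
    next
      case (step m)
      then show ?case using \<tau>[of m] by (simp add: \<tau>_def prefix_of_Suc)
    qed
    let ?t = "prefix_of x (max n (length s))"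
    have "branch (\<sigma> ?t n) ?t x"
      unfolding branch_def
    proof (intro conjI allI impI)
      fix m assume m: "length ?t \<le> m"
      have "bad (take (max n (length s)) (prefix_of x m)) \<longrightarrow>
          \<sigma> (take (max n (length s)) (prefix_of x m)) n (prefix_of x m) (x m)"
        using \<tau>[of m] m unfolding \<tau>_def by simp
      then show "\<sigma> ?t n (prefix_of x m) (x m)"
        using m bad[of "max n (length s)"] by simp
    qed simp
    then show ?thesis using \<sigma>(2) bad[of "max n (length s)"] by simp
  qed
  ultimately show "forces s (\<lambda>x. \<not> (\<exists>n. S n x))"
    unfolding forces_def by blast
qed

lemma decided_all: "(\<And>n :: nat. decided (S n)) \<Longrightarrow> decided (\<lambda>x. \<forall>n. S n x)"
  using decided_not[OF decided_ex[of "\<lambda>n x. \<not> S n x"]] decided_not by simp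

lemma forces_branch_shift:
  assumes "forces [] S"
  shows "\<exists>x. strict_mono x \<and> S x \<and> S (\<lambda>n. x (Suc n))"
proof -
  obtain \<sigma> where \<sigma>: "\<And>t. eventually (\<sigma> t) U" "\<And>x. branch \<sigma> [] x \<Longrightarrow> S x"
    using assms unfolding forces_def by blast
  define P where "P x n r \<longleftrightarrow> \<sigma> (prefix_of x n) r \<and> (n > 0 \<longrightarrow> x (n - 1) < r \<and>
      \<sigma> (prefix_of (\<lambda>i. x (Suc i)) (n - 1)) r)" for x n r
  have "\<exists>x. \<forall>n. P x n (x n)"
  proof (rule dependent_wellorder_choice)
    fix r n and f g :: "nat \<Rightarrow> nat" assume "\<And>y. y < n \<Longrightarrow> f y = g y"
    then have "prefix_of f n = prefix_of g n"
      "n > 0 \<Longrightarrow> prefix_of (\<lambda>i. f (Suc i)) (n - 1) = prefix_of (\<lambda>i. g (Suc i)) (n - 1) \<and> f (n - 1) = g (n - 1)"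
      by (auto simp: prefix_of_def)
    then show "P f n r = P g n r" by (auto simp: P_def)
  next
    fix n and x :: "nat \<Rightarrow> nat"
    have "eventually (\<lambda>r. x (n - 1) < r) U"
      using free eventually_gt_at_top filter_leD by blast
    then have "eventually (P x n) U"
      unfolding P_def by (intro eventually_conj \<sigma>(1)) (auto intro!: eventually_conj \<sigma>(1) elim: eventually_mono)
    then show "\<exists>r. P x n r" using proper eventually_happens' by blast
  qed
  then obtain x where x: "\<And>n. P x n (x n)" by blast
  have "strict_mono x" unfolding strict_mono_Suc_iff using x[of "Suc _"] by (auto simp: P_def)
  moreover have "branch \<sigma> [] x" "branch \<sigma> [] (\<lambda>n. x (Suc n))"
    using x x[of "Suc _"] by (auto simp: branch_def P_def prefix_of_def)
  ultimately show ?thesis using \<sigma>(2) by blast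
qed

lemma shift_colouring:
  fixes c :: "nat \<Rightarrow> (nat \<Rightarrow> nat) \<Rightarrow> 'c"
  assumes fin: "finite Q" and Q: "\<And>k x. c k x \<in> Q"
    and cont: "\<And>k x y. prefix_of x (Suc k) = prefix_of y (Suc k) \<Longrightarrow> c k x = c k y"
    and lim: "\<And>x. \<exists>q n. \<forall>k\<ge>n. c k x = q"
  shows "\<exists>x q n. strict_mono x \<and> (\<forall>k\<ge>n. c k x = q \<and> c k (\<lambda>i. x (Suc i)) = q)"
proof -
  define S where "S q x \<longleftrightarrow> (\<exists>n. \<forall>k. k \<ge> n \<longrightarrow> c k x = q)" for q x
  have "decided (\<lambda>x. k \<ge> n \<longrightarrow> c k x = q)" for k n q
    by (rule decided_of_prefix[of "Suc k"]) (use cont in metis)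
  then have dec: "decided (S q)" for q
    unfolding S_def by (intro decided_ex decided_all)
  have "\<exists>q. forces [] (S q)"
  proof (rule ccontr)
    assume "\<nexists>q. forces [] (S q)"
    then have no: "forces [] (\<lambda>x. \<not> S q x)" for q using dec[of q] unfolding decided_def by blast
    have "forces [] (\<lambda>x. \<forall>q\<in>Q. \<not> S q x)" using fin
    proof (induction Q rule: finite_induct)
      case empty
      then show ?case using forces_mono[OF no] by simp
    next
      case (insert q Q)
      then show ?case using forces_conj[OF no[of q] insert.IH] by (rule_tac forces_mono) auto
    qed
    then obtain x where x: "\<And>q. q \<in> Q \<Longrightarrow> \<not> S q x" using forces_branch_shift by blast
    obtain q n where "\<forall>k\<ge>n. c k x = q" using lim by blast
    then show False using x[of q] Q[of n x] by (auto simp: S_def)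
  qed
  then obtain q x where "strict_mono x" "S q x" "S q (\<lambda>n. x (Suc n))"
    using forces_branch_shift by blast
  then obtain n m where "\<forall>k\<ge>n. c k x = q" "\<forall>k\<ge>m. c k (\<lambda>i. x (Suc i)) = q"
    by (auto simp: S_def)
  then have "\<forall>k\<ge>max n m. c k x = q \<and> c k (\<lambda>i. x (Suc i)) = q" by simp
  then show ?thesis using \<open>strict_mono x\<close> by blast
qed

end

section \<open>A well-quasi-order criterion\<close>

text \<open>In Nash-Williams' style, a bad sequence \<open>T\<close> yields bad arrays \<open>f k\<close> on increasing sequences, where
  \<open>f (k + 1) x\<close> is a child of \<open>f k x\<close> that refutes the comparison with \<open>f k\<close> of the shift of \<open>x\<close>,
  as long as the two labels agree.\<close>

lemma labelled_wqo:
  fixes child :: "('a \<times> 'a) set" and lab :: "'a \<Rightarrow> 'c" and T :: "nat \<Rightarrow> 'a"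
  assumes wf: "wf child" and fin: "finite (range lab)"
    and up: "\<And>S t T. (t, T) \<in> child \<Longrightarrow> leq S t \<Longrightarrow> leq S T"
    and node: "\<And>S T. lab S = lab T \<Longrightarrow> (\<And>s. (s, S) \<in> child \<Longrightarrow> leq s T) \<Longrightarrow> leq S T"
  shows "\<exists>i j. i < j \<and> leq (T i) (T j)"
proof (rule ccontr)
  assume "\<not> ?thesis"
  then have bad: "\<And>i j. i < j \<Longrightarrow> \<not> leq (T i) (T j)" by blast
  obtain U where "free_ultrafilter U" using ex_free_ultrafilter by blast
  then interpret free_ultrafilter U .
  define sh where "sh x = (\<lambda>i. x (Suc i))" for x :: "nat \<Rightarrow> nat"
  define ok where "ok S T s \<longleftrightarrow> lab S = lab T \<and> (s, S) \<in> child \<and> \<not> leq s T" for S T s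
  define nxt where "nxt S T = (if \<exists>s. ok S T s then SOME s. ok S T s else S)" for S T
  define f where "f k = ((\<lambda>g x. nxt (g x) (g (sh x))) ^^ k) (\<lambda>x. T (x 0))" for k
  have f0: "f 0 x = T (x 0)" for x by (simp add: f_def)
  have fS: "f (Suc k) x = nxt (f k x) (f k (sh x))" for k x by (simp add: f_def)
  have nxt: "nxt S T = S \<or> ok S T (nxt S T)" for S T
    unfolding nxt_def by (auto intro: someI_ex)
  have nxt_child: "nxt S T = S \<or> (nxt S T, S) \<in> child" for S T
    using nxt[of S T] by (auto simp: ok_def)
  have cont: "f k x = f k y" if "prefix_of x (Suc k) = prefix_of y (Suc k)" for k x y
    using that
  proof (induction k arbitrary: x y)
    case 0
    then show ?case by (simp add: f0 prefix_of_def)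
  next
    case (Suc k)
    have eq: "x i = y i" if "i < Suc (Suc k)" for i
      using Suc.prems that by (metis nth_prefix_of)
    have "f k x = f k y" "f k (sh x) = f k (sh y)"
      using eq by (intro Suc.IH; force simp: prefix_of_def sh_def)+
    then show ?case by (simp add: fS)
  qed
  have stab: "\<exists>n. \<forall>k\<ge>n. f k x = f n x" for x
  proof -
    have "\<exists>n. \<forall>k\<ge>n. f k x = f n x" if "f m x = S" for S m
      using wf that
    proof (induction S arbitrary: m rule: wf_induct_rule)
      case (less S)
      show ?case
      proof (cases "\<forall>k\<ge>m. f k x = S")
        case True
        then show ?thesis using less.prems by blast
      next
        case False
        define k where "k = (LEAST k. k \<ge> m \<and> f k x \<noteq> S)"
        have k: "k \<ge> m" "f k x \<noteq> S" using False LeastI_ex[of "\<lambda>k. k \<ge> m \<and> f k x \<noteq> S"] by (auto simp: k_def)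
        then obtain j where j: "k = Suc j" "j \<ge> m" using less.prems by (cases k) (auto simp: le_Suc_eq)
        have "f j x = S" using not_less_Least[of j "\<lambda>k. k \<ge> m \<and> f k x \<noteq> S"] j by (auto simp: k_def)
        then have "(f k x, S) \<in> child" using k j nxt_child[of S] by (auto simp: fS)
        then show ?thesis by (rule less.IH) simp
      qed
    qed
    then show ?thesis by blast
  qed
  have inv: "\<not> leq (f k x) (f k (sh x))" if "strict_mono x" for k x
    using that
  proof (induction k arbitrary: x)
    case 0
    then show ?case using bad[of "x 0" "x 1"] by (simp add: f0 sh_def strict_mono_less)
  next
    case (Suc k)
    have "\<not> leq (f (Suc k) x) (f k (sh x))"
      using nxt[of "f k x" "f k (sh x)"] Suc by (auto simp: fS ok_def)
    then show ?case
      using nxt_child[of "f k (sh x)" "f k (sh (sh x))"] up by (auto simp: fS)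
  qed
  have "\<exists>x q n. strict_mono x \<and> (\<forall>k\<ge>n. lab (f k x) = q \<and> lab (f k (\<lambda>i. x (Suc i))) = q)"
    using fin
  proof (rule shift_colouring)
    show "lab (f k x) = lab (f k y)" if "prefix_of x (Suc k) = prefix_of y (Suc k)" for k x y
      using cont[OF that] by simp
    show "\<exists>q n. \<forall>k\<ge>n. lab (f k x) = q" for x using stab[of x] by metis
  qed auto
  then obtain x n where x: "strict_mono x" and n: "\<And>k. k \<ge> n \<Longrightarrow> lab (f k x) = lab (f k (sh x))"
    unfolding sh_def by metis
  obtain m where m: "\<And>k. k \<ge> m \<Longrightarrow> f k x = f m x" using stab[of x] by blast
  define k where "k = max m n"
  have "f (Suc k) x = f k x" using m[of k] m[of "Suc k"] by (simp add: k_def)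
  moreover have "\<exists>s. ok (f k x) (f k (sh x)) s"
    using node[of "f k x" "f k (sh x)"] n[of k] inv[OF x, of k] by (auto simp: k_def ok_def)
  then have "ok (f k x) (f k (sh x)) (nxt (f k x) (f k (sh x)))"
    unfolding nxt_def by (auto intro: someI_ex)
  ultimately show False using wf by (auto simp: fS ok_def)
qed

section \<open>Embeddings and indecomposable trees\<close>

definition emb :: "'a::linorder set \<Rightarrow> 'a set \<Rightarrow> bool" where
  "emb A B \<longleftrightarrow> (\<exists>f. strict_mono_on A f \<and> f ` A \<subseteq> B)"

definition lt :: "bool \<Rightarrow> 'a::linorder \<Rightarrow> 'a \<Rightarrow> bool" where
  "lt b x y = (if b then x < y else y < x)"

definition sep :: "bool \<Rightarrow> 'a::linorder set \<Rightarrow> 'a set \<Rightarrow> bool" where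
  "sep b X Y \<longleftrightarrow> (\<forall>x\<in>X. \<forall>y\<in>Y. lt b x y)"

lemma lt_trans: "lt b x y \<Longrightarrow> lt b y z \<Longrightarrow> lt b x z"
  by (auto simp: lt_def split: if_splits)

lemma lt_irrefl [simp]: "\<not> lt b x x"
  by (simp add: lt_def)

lemma lt_asym: "lt b x y \<Longrightarrow> \<not> lt b y x"
  by (auto simp: lt_def split: if_splits)

lemma lt_linear: "x = y \<or> lt b x y \<or> lt b y x"
  by (auto simp: lt_def)

lemma lt_Not [simp]: "lt (\<not> b) x y = lt b y x"
  by (simp add: lt_def)

lemma strict_mono_on_lt:
  "strict_mono_on A f \<Longrightarrow> x \<in> A \<Longrightarrow> y \<in> A \<Longrightarrow> lt b x y \<Longrightarrow> lt b (f x) (f y)"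
  by (auto simp: lt_def strict_mono_on_def split: if_splits)

lemma sepD: "sep b X Y \<Longrightarrow> x \<in> X \<Longrightarrow> y \<in> Y \<Longrightarrow> lt b x y"
  by (simp add: sep_def)

lemma sep_mono: "sep b X Y \<Longrightarrow> X' \<subseteq> X \<Longrightarrow> Y' \<subseteq> Y \<Longrightarrow> sep b X' Y'"
  by (auto simp: sep_def)

lemma sep_Not [simp]: "sep (\<not> b) X Y = sep b Y X"
  by (auto simp: sep_def)

lemma sep_False: "sep False X Y = sep True Y X"
  by (auto simp: sep_def lt_def)

lemma lt_chain: "(\<And>n. lt b (p n) (p (Suc n))) \<Longrightarrow> i < j \<Longrightarrow> lt b (p i) (p j)"
  by (rule less_Suc_induct[of i j "\<lambda>i j. lt b (p i) (p j)"]) (use lt_trans in blast)+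

lemma emb_subset: "A \<subseteq> B \<Longrightarrow> emb A B"
  unfolding emb_def by (rule exI[of _ id]) (auto simp: strict_mono_on_def)

lemma emb_image: "strict_mono_on A f \<Longrightarrow> f ` A \<subseteq> B \<Longrightarrow> emb A B"
  by (auto simp: emb_def)

lemma strict_mono_on_comp:
  "strict_mono_on A f \<Longrightarrow> strict_mono_on B g \<Longrightarrow> f ` A \<subseteq> B \<Longrightarrow> strict_mono_on A (g \<circ> f)"
  by (fastforce simp: strict_mono_on_def)

lemma emb_trans: "emb A B \<Longrightarrow> emb B C \<Longrightarrow> emb A C"
  unfolding emb_def
proof (elim exE conjE)
  fix f g assume "strict_mono_on A f" "f ` A \<subseteq> B" "strict_mono_on B g" "g ` B \<subseteq> C"
  then show "\<exists>h. strict_mono_on A h \<and> h ` A \<subseteq> C"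
    by (intro exI[of _ "g \<circ> f"]) (auto intro: strict_mono_on_comp)
qed

lemma emb_mono: "emb A B \<Longrightarrow> A' \<subseteq> A \<Longrightarrow> B \<subseteq> B' \<Longrightarrow> emb A' B'"
  using emb_trans emb_subset by metis

lemma emb_UN:
  fixes I :: "nat set"
  assumes emb: "\<And>i. i \<in> I \<Longrightarrow> emb (A i) (B i)"
    and A: "\<And>i j. i \<in> I \<Longrightarrow> j \<in> I \<Longrightarrow> i < j \<Longrightarrow> sep b (A i) (A j)"
    and B: "\<And>i j. i \<in> I \<Longrightarrow> j \<in> I \<Longrightarrow> i < j \<Longrightarrow> sep b (B i) (B j)"
  shows "emb (\<Union>i\<in>I. A i) (\<Union>i\<in>I. B i)"
proof -
  obtain h where h: "\<And>i. i \<in> I \<Longrightarrow> strict_mono_on (A i) (h i)" "\<And>i. i \<in> I \<Longrightarrow> h i ` A i \<subseteq> B i"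
    using emb unfolding emb_def by metis
  define ix where "ix x = (SOME i. i \<in> I \<and> x \<in> A i)" for x
  have ix: "ix x \<in> I \<and> x \<in> A (ix x)" if "x \<in> (\<Union>i\<in>I. A i)" for x
    unfolding ix_def by (rule someI_ex) (use that in auto)
  define f where "f x = h (ix x) x" for x
  have fB: "f x \<in> B (ix x)" if "x \<in> (\<Union>i\<in>I. A i)" for x
    using ix[OF that] h(2) by (auto simp: f_def)
  have lt: "lt b (f x) (f y)" if x: "x \<in> (\<Union>i\<in>I. A i)" and y: "y \<in> (\<Union>i\<in>I. A i)" and xy: "lt b x y" for x y
  proof -
    have "\<not> ix y < ix x"
      using sepD[OF A[of "ix y" "ix x"]] ix[OF x] ix[OF y] xy lt_asym by blast
    then consider "ix x = ix y" | "ix x < ix y" by linarith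
    then show ?thesis
    proof cases
      case 1
      then show ?thesis
        using strict_mono_on_lt[OF h(1)] ix[OF x] ix[OF y] xy unfolding f_def by metis
    next
      case 2
      then show ?thesis using sepD[OF B] ix x y fB by metis
    qed
  qed
  have "strict_mono_on (\<Union>i\<in>I. A i) f"
    using lt unfolding strict_mono_on_def lt_def by (cases b) auto
  then show ?thesis by (rule emb_image) (use fB ix in blast)
qed

lemma emb_recurrent:
  assumes A: "\<And>i j :: nat. i < j \<Longrightarrow> sep b (A i) (A j)"
    and B: "\<And>i j :: nat. i < j \<Longrightarrow> sep b (B i) (B j)"
    and rec: "\<And>i n. \<exists>m\<ge>n. emb (A i) (B m)"
  shows "emb (\<Union>i. A i) (\<Union>m\<in>{n..}. B m)"
proof -
  have "\<exists>m. \<forall>i. (m i \<ge> n \<and> emb (A i) (B (m i))) \<and> m i < m (Suc i)"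
  proof (rule dependent_nat_choice)
    fix k i
    obtain m where "m \<ge> max n (Suc k)" "emb (A (Suc i)) (B m)" using rec by blast
    then show "\<exists>m. (n \<le> m \<and> emb (A (Suc i)) (B m)) \<and> k < m" by auto
  qed (use rec in blast)
  then obtain m where m: "\<And>i. m i \<ge> n" "\<And>i. emb (A i) (B (m i))" and "\<And>i. m i < m (Suc i)"
    by blast
  then have mono: "strict_mono m" by (simp add: strict_mono_Suc_iff)
  have "emb (\<Union>i. A i) (\<Union>i. B (m i))"
    by (rule emb_UN[where b = b]) (use m A B mono in \<open>auto simp: strict_mono_less\<close>)
  then show ?thesis by (rule emb_mono) (use m in auto)
qed

text \<open>A node denotes the \<open>\<omega>\<close>-sum (flag \<open>True\<close>) or the \<open>\<omega>\<close>*-sum (flag \<open>False\<close>) of its children.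
  In a valid tree each child of a node embeds into infinitely many of its siblings, so that valid trees denote
  the hereditarily indecomposable scattered orders.\<close>

datatype 'a htree = Leaf 'a | Node bool "nat \<Rightarrow> 'a htree"

primrec carrier :: "'a htree \<Rightarrow> 'a set" where
  "carrier (Leaf x) = {x}"
| "carrier (Node b ts) = (\<Union>i. carrier (ts i))"

primrec valid :: "'a::linorder htree \<Rightarrow> bool" where
  "valid (Leaf x) = True"
| "valid (Node b ts) = ((\<forall>i. valid (ts i)) \<and>
     (\<forall>i j. i < j \<longrightarrow> sep b (carrier (ts i)) (carrier (ts j))) \<and>
     (\<forall>i n. \<exists>j\<ge>n. emb (carrier (ts i)) (carrier (ts j))))"

primrec dir :: "'a htree \<Rightarrow> bool" where
  "dir (Leaf x) = True"
| "dir (Node b ts) = b"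

definition tail :: "'a::linorder htree \<Rightarrow> 'a \<Rightarrow> 'a set" where
  "tail T a = {y \<in> carrier T. y = a \<or> lt (dir T) a y}"

lemma carrier_nonempty: "carrier T \<noteq> {}"
  by (induction T) auto

lemma tail_subset: "tail T a \<subseteq> carrier T"
  by (auto simp: tail_def)

lemma tail_self: "a \<in> carrier T \<Longrightarrow> a \<in> tail T a"
  by (auto simp: tail_def)

lemma emb_Node:
  assumes S: "valid (Node b ss)" and T: "valid (Node b ts)"
    and emb: "\<And>i. \<exists>j. emb (carrier (ss i)) (carrier (ts j))"
  shows "emb (carrier (Node b ss)) (\<Union>m\<in>{n..}. carrier (ts m))"
  unfolding carrier.simps
proof (rule emb_recurrent[where b = b])
  fix i n
  obtain j where "emb (carrier (ss i)) (carrier (ts j))" using emb by blast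
  moreover obtain m where "m \<ge> n" "emb (carrier (ts j)) (carrier (ts m))"
    using T unfolding valid.simps by blast
  ultimately show "\<exists>m\<ge>n. emb (carrier (ss i)) (carrier (ts m))" using emb_trans by blast
qed (use S T in auto)

lemma emb_tail:
  assumes T: "valid T" and a: "a \<in> carrier T"
  shows "emb (carrier T) (tail T a)"
proof (cases T)
  case (Leaf x)
  then show ?thesis using a by (intro emb_subset) (auto simp: tail_def)
next
  case (Node b ts)
  then obtain k where k: "a \<in> carrier (ts k)" using a by auto
  have "emb (carrier T) (\<Union>m\<in>{Suc k..}. carrier (ts m))"
    unfolding Node by (rule emb_Node) (use T Node emb_subset in auto)
  then show ?thesis
  proof (rule emb_mono)
    show "(\<Union>m\<in>{Suc k..}. carrier (ts m)) \<subseteq> tail T a"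
      using T k unfolding Node tail_def by (fastforce simp: Suc_le_eq intro: sepD)
  qed simp
qed

lemma Node_no_last:
  assumes "valid (Node b ts)" "a \<in> carrier (Node b ts)"
  shows "\<exists>c\<in>carrier (Node b ts). lt b a c"
proof -
  obtain k where k: "a \<in> carrier (ts k)" using assms by auto
  obtain c where c: "c \<in> carrier (ts (Suc k))" using carrier_nonempty[of "ts (Suc k)"] by blast
  have "sep b (carrier (ts k)) (carrier (ts (Suc k)))" using assms by simp
  then show ?thesis using sepD k c by fastforce
qed

lemma emb_Node_above:
  assumes T: "valid (Node b ts)" and a: "a \<in> carrier (Node b ts)"
  shows "emb (carrier (Node b ts)) {y \<in> carrier (Node b ts). lt b a y}"
proof -
  obtain c where c: "c \<in> carrier (Node b ts)" "lt b a c" using Node_no_last[OF assms] by blast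
  show ?thesis
    by (rule emb_mono[OF emb_tail[OF T c(1)]]) (use c lt_trans in \<open>auto simp: tail_def\<close>)
qed

lemma Node_below_subset:
  assumes T: "valid (Node b ts)" and c: "c \<in> carrier (ts k)"
  shows "{y \<in> carrier (Node b ts). lt b y c} \<subseteq> (\<Union>i<Suc k. carrier (ts i))"
proof clarify
  fix y assume "y \<in> carrier (Node b ts)" "lt b y c"
  then obtain i where i: "y \<in> carrier (ts i)" by auto
  have "i \<le> k"
  proof (rule ccontr)
    assume "\<not> i \<le> k"
    then have "sep b (carrier (ts k)) (carrier (ts i))" using T by simp
    then show False using sepD c i \<open>lt b y c\<close> lt_asym by metis
  qed
  then show "y \<in> (\<Union>i<Suc k. carrier (ts i))" using i by auto
qed

text \<open>An open tree, marked \<open>False\<close>, stands between a node and its children; it has a label of its own and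
  compares with a node only below some child. This separates the levels of the trees.\<close>

theorem valid_wqo:
  fixes T :: "nat \<Rightarrow> 'a::linorder htree"
  assumes T: "\<And>i. valid (T i)"
  shows "\<exists>i j. i < j \<and> emb (carrier (T i)) (carrier (T j))"
proof -
  define child :: "(('a htree \<times> bool) \<times> ('a htree \<times> bool)) set" where
    "child = {((ts i, False), (Node b ts, True)) | b ts i. True} \<union> {((t, True), (t, False)) | t. True}"
  define lab :: "'a htree \<times> bool \<Rightarrow> nat" where
    "lab S = (if snd S then (case fst S of Leaf x \<Rightarrow> 1 | Node b ts \<Rightarrow> if b then 2 else 3) else 0)" for S
  define leq where "leq S T \<longleftrightarrow> (valid (fst S) \<and> valid (fst T) \<longrightarrow>
      (if \<not> snd S \<and> snd T then (\<exists>b ts j. fst T = Node b ts \<and> emb (carrier (fst S)) (carrier (ts j)))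
       else emb (carrier (fst S)) (carrier (fst T))))" for S T :: "'a htree \<times> bool"
  have "\<exists>i j. i < j \<and> leq (T i, True) (T j, True)"
  proof (rule labelled_wqo)
    have "\<forall>c. P (t, c)" if step: "\<And>S. (\<And>s. (s, S) \<in> child \<Longrightarrow> P s) \<Longrightarrow> P S" for P and t
    proof (induction t)
      case (Leaf x)
      have *: "P (Leaf x, True)" by (rule step) (auto simp: child_def)
      moreover have "P (Leaf x, False)" by (rule step) (use * in \<open>auto simp: child_def\<close>)
      ultimately show ?case by (metis (full_types))
    next
      case (Node b ts)
      have *: "P (Node b ts, True)" by (rule step) (use Node in \<open>auto simp: child_def\<close>)
      moreover have "P (Node b ts, False)" by (rule step) (use * in \<open>auto simp: child_def\<close>)
      ultimately show ?case by (metis (full_types))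
    qed
    then show "wf child" unfolding wf_def by (metis surj_pair)
    have "range lab \<subseteq> {0, 1, 2, 3}" by (auto simp: lab_def split: htree.splits)
    then show "finite (range lab)" using finite_subset by blast
  next
    fix S t T assume "(t, T) \<in> child" "leq S t"
    then consider b ts i where "t = (ts i, False)" "T = (Node b ts, True)"
      | u where "t = (u, True)" "T = (u, False)" by (auto simp: child_def)
    then show "leq S T"
    proof cases
      case 1
      then show ?thesis
        using \<open>leq S t\<close> emb_mono[of "carrier (fst S)" "carrier (ts i)" "carrier (fst S)" "carrier (Node b ts)"]
        by (cases "snd S") (auto simp: leq_def)
    next
      case 2
      have "emb (carrier (fst S)) (carrier u)"
        if "fst (u, True) = Node b ts" "emb (carrier (fst S)) (carrier (ts j))" for b ts j
        using that by (auto elim!: emb_mono)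
      then show ?thesis using \<open>leq S t\<close> 2 by (auto simp: leq_def split: if_splits)
    qed
  next
    fix S T assume lab: "lab S = lab T" and le: "\<And>s. (s, S) \<in> child \<Longrightarrow> leq s T"
    obtain s c t d where ST: "S = (s, c)" "T = (t, d)" by force
    have "c = d" using lab ST by (auto simp: lab_def split: htree.splits if_splits)
    show "leq S T"
    proof (cases c)
      case False
      have "leq (s, True) T" by (rule le) (use ST False in \<open>auto simp: child_def\<close>)
      then show ?thesis using ST False \<open>c = d\<close> by (auto simp: leq_def)
    next
      case True
      show ?thesis
      proof (cases s)
        case (Leaf x)
        then obtain y where "t = Leaf y" using lab ST True \<open>c = d\<close>
          by (cases t) (auto simp: lab_def split: if_splits)
        moreover have "emb {x} {y}" by (rule emb_image[of _ "\<lambda>_. y"]) (auto simp: strict_mono_on_def)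
        ultimately show ?thesis using Leaf ST True \<open>c = d\<close> by (auto simp: leq_def)
      next
        case (Node b ss)
        then obtain ts where t: "t = Node b ts" using lab ST True \<open>c = d\<close>
          by (cases t) (auto simp: lab_def split: if_splits)
        have "leq (ss i, False) T" for i by (rule le) (use ST True Node in \<open>auto simp: child_def\<close>)
        then have "emb (carrier s) (carrier t)" if "valid s" "valid t"
          using emb_Node[of b ss ts 0] that ST Node t True \<open>c = d\<close> by (auto simp: leq_def)
        then show ?thesis using ST True \<open>c = d\<close> by (auto simp: leq_def)
      qed
    qed
  qed
  then show ?thesis using T by (auto simp: leq_def)
qed

lemma core_exists:
  fixes B :: "nat \<Rightarrow> 'a::linorder set"
  assumes f: "strict_mono_on (carrier T) f" and im: "f ` carrier T \<subseteq> (\<Union>i<n. B i)"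
    and B: "\<And>i j. i < j \<Longrightarrow> j < n \<Longrightarrow> sep c (B i) (B j)"
  shows "\<exists>i<n. \<exists>a\<in>carrier T. f ` tail T a \<subseteq> B i"
proof -
  define J where "J = {i. i < n \<and> (\<exists>a\<in>carrier T. f a \<in> B i)}"
  have J: "finite J" unfolding J_def by (rule finite_subset[of _ "{..<n}"]) auto
  obtain a0 where "a0 \<in> carrier T" using carrier_nonempty[of T] by blast
  then have "J \<noteq> {}" using im by (fastforce simp: J_def)
  note J = J this
  define i where "i = (if c = dir T then Max J else Min J)"
  have "i \<in> J" using J by (simp add: i_def)
  then obtain a where i: "i < n" and a: "a \<in> carrier T" "f a \<in> B i" by (auto simp: J_def)
  have "f y \<in> B i" if "y \<in> tail T a" for y
  proof (cases "y = a")
    case False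
    then have y: "y \<in> carrier T" "lt (dir T) a y" using that by (auto simp: tail_def)
    then obtain j where j: "j < n" "f y \<in> B j" using im by blast
    then have "j \<in> J" using y by (auto simp: J_def)
    then have *: "if c = dir T then j \<le> i else i \<le> j" using J by (simp add: i_def)
    have lt: "lt (dir T) (f a) (f y)" using strict_mono_on_lt[OF f] a y by blast
    have "j = i"
    proof (rule ccontr)
      assume "j \<noteq> i"
      show False
      proof (cases "c = dir T")
        case True
        then have "j < i" using * \<open>j \<noteq> i\<close> by simp
        then have "lt c (f y) (f a)" using sepD[OF B] i j a by blast
        then show False using lt lt_asym True by blast
      next
        case False
        then have "i < j" using * \<open>j \<noteq> i\<close> by simp
        then have "lt c (f a) (f y)" using sepD[OF B] j a by blast
        moreover have "dir T = (\<not> c)" using False by auto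
        ultimately show False using lt lt_asym by auto
      qed
    qed
    then show ?thesis using j by simp
  qed (use a in simp)
  then show ?thesis using i a by blast
qed

lemma emb_into_part:
  fixes B :: "nat \<Rightarrow> 'a::linorder set"
  assumes T: "valid T" and emb: "emb (carrier T) (\<Union>i<n. B i)"
    and B: "\<And>i j. i < j \<Longrightarrow> j < n \<Longrightarrow> sep c (B i) (B j)"
  shows "\<exists>i<n. emb (carrier T) (B i)"
proof -
  obtain f where f: "strict_mono_on (carrier T) f" "f ` carrier T \<subseteq> (\<Union>i<n. B i)"
    using emb by (auto simp: emb_def)
  then obtain i a where ia: "i < n" "a \<in> carrier T" "f ` tail T a \<subseteq> B i" using core_exists B by metis
  have "emb (tail T a) (B i)"
    using ia by (intro emb_image[OF monotone_on_subset[OF f(1) tail_subset]])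
  then show ?thesis using emb_tail[OF T ia(2)] emb_trans ia(1) by blast
qed

lemma merge_valid:
  assumes "valid T" "valid (Node b us)" "sep b (carrier T) (carrier (Node b us))"
    and "emb (carrier T) (carrier (us i))"
  shows "\<exists>V. valid V \<and> carrier V = carrier T \<union> carrier (Node b us)"
proof (intro exI conjI)
  let ?V = "Node b (case_nat T us)"
  have rec: "\<exists>m\<ge>n. emb (carrier (us i)) (carrier (us m))" for i n using assms(2) by auto
  have "\<exists>j\<ge>n. emb (carrier (case_nat T us i)) (carrier (case_nat T us j))" for i n
  proof -
    obtain m where "m \<ge> n" "emb (carrier (case_nat T us i)) (carrier (us m))"
      using assms(4) rec emb_trans by (cases i) (simp, blast)+
    then show ?thesis by (intro exI[of _ "Suc m"]) auto
  qed
  moreover have "sep b (carrier (case_nat T us i)) (carrier (case_nat T us j))" if "i < j" for i j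
    using that assms by (auto split: nat.splits simp: sep_def)
  moreover have "valid (case_nat T us i)" for i using assms by (auto split: nat.splits)
  ultimately show "valid ?V" by auto
  show "carrier ?V = carrier T \<union> carrier (Node b us)"
    by (auto split: nat.splits)
qed

section \<open>Scattered sets\<close>

definition scattered_set :: "'a::linorder set \<Rightarrow> bool" where
  "scattered_set L \<longleftrightarrow> \<not> (\<exists>f :: rat \<Rightarrow> 'a. strict_mono f \<and> range f \<subseteq> L)"

lemma not_scattered_if_split:
  fixes L :: "'a::linorder set"
  assumes P: "\<And>x y. P x y \<Longrightarrow> x \<in> L \<and> y \<in> L \<and> x < y"
    and mono: "\<And>x y x' y'. P x y \<Longrightarrow> x' \<in> L \<Longrightarrow> y' \<in> L \<Longrightarrow> x' \<le> x \<Longrightarrow> y \<le> y' \<Longrightarrow> P x' y'"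
    and split: "\<And>x y. P x y \<Longrightarrow> \<exists>z. P x z \<and> P z y"
    and base: "P x0 y0"
  shows "\<not> scattered_set L"
proof -
  define r :: "nat \<Rightarrow> rat" where "r = from_nat"
  define Q where "Q f n z \<longleftrightarrow> P x0 z \<and> P z y0 \<and>
     (\<forall>i<n. (r i < r n \<longrightarrow> P (f i) z) \<and> (r n < r i \<longrightarrow> P z (f i)))" for f n z
  have "\<exists>f. \<forall>n. Q f n (f n)"
  proof (rule dependent_wellorder_choice)
    show "Q f n z = Q g n z" if "\<And>i. i < n \<Longrightarrow> f i = g i" for f g n z
      using that by (auto simp: Q_def)
  next
    fix n f assume f: "\<And>i. i < n \<Longrightarrow> Q f i (f i)"
    have pair: "P (f i) (f j)" if "i < n" "j < n" "r i < r j" for i j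
      using f[OF that(1)] f[OF that(2)] that by (cases "i < j"; cases "i = j") (auto simp: Q_def)
    define lo where "lo = insert x0 (f ` {i. i < n \<and> r i < r n})"
    define hi where "hi = insert y0 (f ` {i. i < n \<and> r n < r i})"
    have fin: "finite lo" "finite hi" "lo \<noteq> {}" "hi \<noteq> {}" by (auto simp: lo_def hi_def)
    have lohi: "P l h" if "l \<in> lo" "h \<in> hi" for l h
      using that base f pair by (fastforce simp: lo_def hi_def Q_def)
    then obtain z where z: "P (Max lo) z" "P z (Min hi)" using fin split Max_in Min_in by metis
    have L: "lo \<subseteq> L" "hi \<subseteq> L" using lohi P fin by blast+
    have "P l z" if "l \<in> lo" for l
      using mono[OF z(1), of l z] that L fin P[OF z(1)] by auto
    moreover have "P z h" if "h \<in> hi" for h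
      using mono[OF z(2), of z h] that L fin P[OF z(2)] by auto
    ultimately have "Q f n z" by (auto simp: Q_def lo_def hi_def)
    then show "\<exists>z. Q f n z" ..
  qed
  then obtain f where f: "\<And>n. Q f n (f n)" by blast
  have "f (to_nat q) < f (to_nat q')" if "q < q'" for q q' :: rat
  proof -
    have "to_nat q \<noteq> to_nat q'" using that by auto
    then consider "to_nat q < to_nat q'" | "to_nat q' < to_nat q" by linarith
    then have "P (f (to_nat q)) (f (to_nat q'))"
      using f[of "to_nat q"] f[of "to_nat q'"] that by cases (auto simp: Q_def r_def)
    then show ?thesis using P by blast
  qed
  then have "strict_mono (\<lambda>q :: rat. f (to_nat q))" by (simp add: strict_mono_def)
  moreover have "range (\<lambda>q :: rat. f (to_nat q)) \<subseteq> L" using f P by (auto simp: Q_def)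
  ultimately show ?thesis unfolding scattered_set_def by blast
qed

lemma not_emb_below:
  assumes T: "valid (Node b ts)" and L: "carrier (Node b ts) \<subseteq> L" "scattered_set L"
    and c: "c \<in> carrier (Node b ts)"
  shows "\<not> emb (carrier (Node b ts)) {y \<in> carrier (Node b ts). lt b y c}"
proof
  define A where "A = carrier (Node b ts)"
  define P where "P x y \<longleftrightarrow> x \<in> A \<and> y \<in> A \<and> emb A {z \<in> A. x < z \<and> z < y}" for x y
  assume "emb (carrier (Node b ts)) {y \<in> carrier (Node b ts). lt b y c}"
  then have below: "emb A {y \<in> A. lt b y c}" by (simp add: A_def)
  have cA: "c \<in> A" using c by (simp add: A_def)
  have above: "emb A {y \<in> A. lt b c y}" using emb_Node_above[OF T c] by (simp add: A_def)
  have split: "\<exists>z\<in>A. emb A {w \<in> A. lt b x w \<and> lt b w z} \<and> emb A {w \<in> A. lt b z w \<and> lt b w y}"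
    if e: "emb A {z \<in> A. lt b x z \<and> lt b z y}" for x y
  proof -
    obtain h where h: "strict_mono_on A h" "h ` A \<subseteq> {z \<in> A. lt b x z \<and> lt b z y}"
      using e by (auto simp: emb_def)
    have h_lt: "lt b (h u) (h v)" if "u \<in> A" "v \<in> A" "lt b u v" for u v
      using strict_mono_on_lt[OF h(1)] that by blast
    have "emb {y \<in> A. lt b y c} {w \<in> A. lt b x w \<and> lt b w (h c)}"
      using h h_lt cA by (intro emb_image[of _ h]) (auto intro: monotone_on_subset)
    moreover have "emb {y \<in> A. lt b c y} {w \<in> A. lt b (h c) w \<and> lt b w y}"
      using h h_lt cA by (intro emb_image[of _ h]) (auto intro: monotone_on_subset)
    ultimately show ?thesis using h(2) cA below above emb_trans by blast
  qed
  obtain v where v: "strict_mono_on A v" "v ` A \<subseteq> {y \<in> A. lt b c y}"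
    using above by (auto simp: emb_def)
  have "\<not> scattered_set A"
  proof (rule not_scattered_if_split)
    show "x \<in> A \<and> y \<in> A \<and> x < y" if "P x y" for x y
      using that cA by (auto simp: P_def emb_def)
    show "P x' y'" if "P x y" "x' \<in> A" "y' \<in> A" "x' \<le> x" "y \<le> y'" for x y x' y'
      using that by (auto simp: P_def intro: emb_mono)
    show "\<exists>z. P x z \<and> P z y" if "P x y" for x y
      using split[of x y] split[of y x] that
      by (cases b) (auto simp: P_def lt_def conj_commute)
    have "emb {y \<in> A. lt b y c} {w \<in> A. lt b c w \<and> lt b w (v c)}"
      using v strict_mono_on_lt[OF v(1)] cA
      by (intro emb_image[of _ v]) (auto intro: monotone_on_subset)
    then have "emb A {w \<in> A. lt b c w \<and> lt b w (v c)}" using below emb_trans by blast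
    then show "P (if b then c else v c) (if b then v c else c)"
      using cA v(2) by (auto simp: P_def lt_def conj_commute)
  qed
  moreover have "scattered_set A" using L unfolding scattered_set_def A_def by (meson subset_trans)
  ultimately show False by blast
qed

lemma collapse_merge:
  assumes T: "valid T" and U: "valid U" and L: "carrier T \<subseteq> L" "scattered_set L"
    and sep: "sep c (carrier T) (carrier U)"
    and f: "strict_mono_on (carrier T \<union> carrier U) f"
    and a: "a \<in> carrier T" "f ` tail T a \<subseteq> carrier T"
    and u: "u \<in> carrier U" "f ` tail U u \<subseteq> carrier T"
  shows "\<exists>V. valid V \<and> carrier V = carrier T \<union> carrier U"
proof -
  have lt: "lt c (f x) (f y)" if "x \<in> carrier T" "y \<in> carrier U" for x y
    using strict_mono_on_lt[OF f] sepD[OF sep] that by blast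
  have fa: "f a \<in> carrier T" and fu: "f u \<in> carrier T" using a u tail_self by blast+
  have fT: "strict_mono_on (tail T a) f" and fU: "strict_mono_on (tail U u) f"
    using f tail_subset by (auto intro: monotone_on_subset)
  show ?thesis
  proof (cases T)
    case (Leaf x)
    then show ?thesis using fa fu lt[of a u] a(1) u(1) by auto
  next
    case (Node b ts)
    show ?thesis
    proof (cases "b = c")
      case True
      have "emb (tail T a) {y \<in> carrier T. lt b y (f u)}"
        using a lt tail_subset True u(1) by (intro emb_image[OF fT]) blast
      then have "emb (carrier T) {y \<in> carrier T. lt b y (f u)}" using emb_tail[OF T a(1)] emb_trans by blast
      then show ?thesis using not_emb_below[of b ts L "f u"] T L fu Node by auto
    next
      case False
      then have b: "c = (\<not> b)" by auto
      have lt': "lt b (f y) (f x)" if "x \<in> carrier T" "y \<in> carrier U" for x y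
        using lt[OF that] b by simp
      obtain k where k: "f a \<in> carrier (ts k)" using fa Node by auto
      have "emb (tail U u) {y \<in> carrier T. lt b y (f a)}"
        using u lt' tail_subset a(1) by (intro emb_image[OF fU]) blast
      then have "emb (carrier U) {y \<in> carrier T. lt b y (f a)}" using emb_tail[OF U u(1)] emb_trans by blast
      then have "emb (carrier U) (\<Union>i<Suc k. carrier (ts i))"
        using Node_below_subset[of b ts "f a" k] T k Node emb_mono by blast
      then have "\<exists>i<Suc k. emb (carrier U) (carrier (ts i))"
        by (rule emb_into_part[OF U, where c = b]) (use T Node in auto)
      then obtain i where "emb (carrier U) (carrier (ts i))" by blast
      then show ?thesis using merge_valid[OF U, of b ts i] T Node sep b by (auto simp: Un_commute)
    qed
  qed
qed

section \<open>Finite decompositions\<close>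

definition decomp :: "'a::linorder htree list \<Rightarrow> 'a set \<Rightarrow> bool" where
  "decomp ts A \<longleftrightarrow> (\<forall>t\<in>set ts. valid t) \<and>
     sorted_wrt (\<lambda>s t. sep True (carrier s) (carrier t)) ts \<and> (\<Union>t\<in>set ts. carrier t) = A"

definition fin_decomp :: "'a::linorder set \<Rightarrow> bool" where
  "fin_decomp A \<longleftrightarrow> (\<exists>ts. decomp ts A)"

lemma fin_decomp_empty [simp]: "fin_decomp {}"
  unfolding fin_decomp_def decomp_def by (rule exI[of _ "[]"]) simp

lemma fin_decomp_carrier: "valid t \<Longrightarrow> fin_decomp (carrier t)"
  unfolding fin_decomp_def decomp_def by (rule exI[of _ "[t]"]) simp

lemma fin_decomp_singleton [simp]: "fin_decomp {x}"
  using fin_decomp_carrier[of "Leaf x"] by simp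

lemma decomp_append:
  assumes "decomp ss A" "decomp ts B" "sep True A B"
  shows "decomp (ss @ ts) (A \<union> B)"
  using assms unfolding decomp_def by (auto simp: sorted_wrt_append intro!: sep_mono[OF assms(3)])

lemma fin_decomp_Un:
  assumes "fin_decomp A" "fin_decomp B" "sep b A B"
  shows "fin_decomp (A \<union> B)"
proof (cases b)
  case True
  then show ?thesis using assms decomp_append unfolding fin_decomp_def by metis
next
  case False
  then have "sep True B A" using assms(3) by (simp add: sep_False)
  then show ?thesis using assms decomp_append unfolding fin_decomp_def by (metis Un_commute)
qed

lemma fin_decomp_sum:
  fixes A :: "nat \<Rightarrow> 'a::linorder set"
  assumes fd: "\<And>i. fin_decomp (A i)" and ne: "\<And>i. A i \<noteq> {}"
    and sep: "\<And>i j. i < j \<Longrightarrow> sep b (A i) (A j)"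
  shows "fin_decomp (\<Union>i. A i)"
proof -
  have "\<exists>ts. (\<forall>t\<in>set ts. valid t) \<and> sorted_wrt (\<lambda>s t. sep b (carrier s) (carrier t)) ts \<and>
      (\<Union>t\<in>set ts. carrier t) = A i" for i
  proof -
    obtain ts where ts: "decomp ts (A i)" using fd unfolding fin_decomp_def by blast
    then show ?thesis unfolding decomp_def
      by (intro exI[of _ "if b then ts else rev ts"]) (auto simp: sorted_wrt_rev sep_False)
  qed
  then obtain ts where ts: "\<And>i t. t \<in> set (ts i) \<Longrightarrow> valid t"
    "\<And>i. sorted_wrt (\<lambda>s t. sep b (carrier s) (carrier t)) (ts i)"
    "\<And>i. (\<Union>t\<in>set (ts i). carrier t) = A i" by metis
  have ts_ne: "ts i \<noteq> []" for i using ne[of i] ts(3)[of i] by (metis UN_empty list.set(1))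
  define rcr where "rcr t \<longleftrightarrow> (\<forall>n. \<exists>m\<ge>n. \<exists>t'\<in>set (ts m). emb (carrier t) (carrier t'))" for t
  have "\<exists>N. \<forall>i\<ge>N. \<forall>t\<in>set (ts i). rcr t"
  proof (rule ccontr)
    assume "\<not> ?thesis"
    then have ex: "\<exists>i\<ge>N. \<exists>t\<in>set (ts i). \<not> rcr t" for N by auto
    have "\<exists>f. \<forall>k :: nat. (snd (f k) \<in> set (ts (fst (f k))) \<and> \<not> rcr (snd (f k))) \<and>
      (fst (f k) < fst (f (Suc k)) \<and>
        (\<forall>m\<ge>fst (f (Suc k)). \<forall>t\<in>set (ts m). \<not> emb (carrier (snd (f k))) (carrier t)))"
    proof (rule dependent_nat_choice)
      show "\<exists>p. snd p \<in> set (ts (fst p)) \<and> \<not> rcr (snd p)" using ex[of 0] by force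
      fix p :: "nat \<times> 'a htree" assume "snd p \<in> set (ts (fst p)) \<and> \<not> rcr (snd p)"
      then obtain n where n: "\<forall>m\<ge>n. \<forall>t\<in>set (ts m). \<not> emb (carrier (snd p)) (carrier t)"
        unfolding rcr_def by blast
      obtain i t where it: "i \<ge> max n (Suc (fst p))" "t \<in> set (ts i)" "\<not> rcr t" using ex by blast
      have "\<forall>m\<ge>i. \<forall>t\<in>set (ts m). \<not> emb (carrier (snd p)) (carrier t)"
        using n it(1) by (meson max.boundedE order_trans)
      with it show "\<exists>q. (snd q \<in> set (ts (fst q)) \<and> \<not> rcr (snd q)) \<and> fst p < fst q \<and>
          (\<forall>m\<ge>fst q. \<forall>t\<in>set (ts m). \<not> emb (carrier (snd p)) (carrier t))"
        by (intro exI[of _ "(i, t)"]) auto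
    qed
    then obtain f where f: "\<forall>k :: nat. (snd (f k) \<in> set (ts (fst (f k))) \<and> \<not> rcr (snd (f k))) \<and>
      (fst (f k) < fst (f (Suc k)) \<and>
        (\<forall>m\<ge>fst (f (Suc k)). \<forall>t\<in>set (ts m). \<not> emb (carrier (snd (f k))) (carrier t)))" ..
    have f: "snd (f k) \<in> set (ts (fst (f k)))" "fst (f k) < fst (f (Suc k))"
      "m \<ge> fst (f (Suc k)) \<Longrightarrow> t \<in> set (ts m) \<Longrightarrow> \<not> emb (carrier (snd (f k))) (carrier t)" for k m t
      using spec[OF f, of k] by simp_all
    have mono: "strict_mono (\<lambda>k. fst (f k))" using f(2) by (simp add: strict_mono_Suc_iff)
    obtain k l where kl: "k < l" "emb (carrier (snd (f k))) (carrier (snd (f l)))"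
      using valid_wqo[of "\<lambda>k. snd (f k)"] ts(1) f(1) by blast
    have "fst (f (Suc k)) \<le> fst (f l)" using kl(1) strict_mono_less_eq[OF mono] by simp
    then show False using f(1,3) kl(2) by blast
  qed
  then obtain N where N: "\<And>i t. i \<ge> N \<Longrightarrow> t \<in> set (ts i) \<Longrightarrow> rcr t" by blast
  define pre where "pre n = concat (map (\<lambda>i. ts (N + i)) [0..<n])" for n
  have pre_Suc: "pre (Suc n) = pre n @ ts (N + n)" for n by (simp add: pre_def)
  have pre_set: "t \<in> set (pre n) \<longleftrightarrow> (\<exists>i<n. t \<in> set (ts (N + i)))" for t n by (auto simp: pre_def)
  have pre_len: "n \<le> length (pre n)" for n
  proof (induction n)
    case (Suc n)
    then show ?case using ts_ne[of "N + n"] by (cases "ts (N + n)") (auto simp: pre_Suc)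
  qed (simp add: pre_def)
  have pre_nth: "pre n ! k = pre m ! k" if "m \<le> n" "k < length (pre m)" for m n k
    using that
  proof (induction n rule: dec_induct)
    case (step n)
    have "length (pre m) \<le> length (pre n)" using step.hyps(1)
      by (induction n rule: dec_induct) (auto simp: pre_Suc)
    then show ?case using step by (simp add: pre_Suc nth_append)
  qed simp
  have pre_sorted: "sorted_wrt (\<lambda>s t. sep b (carrier s) (carrier t)) (pre n)" for n
  proof (induction n)
    case (Suc n)
    have "sep b (carrier s) (carrier t)" if "s \<in> set (pre n)" "t \<in> set (ts (N + n))" for s t
    proof -
      obtain i where "i < n" "s \<in> set (ts (N + i))" using \<open>s \<in> set (pre n)\<close> pre_set by blast
      then show ?thesis using that ts(3) by (intro sep_mono[OF sep[of "N + i" "N + n"]]) auto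
    qed
    then show ?case using Suc ts(2) by (auto simp: pre_Suc sorted_wrt_append)
  qed (simp add: pre_def)
  define flat where "flat k = pre (Suc k) ! k" for k
  have flat: "flat k = pre n ! k" if "k < length (pre n)" for k n
    using that pre_nth[of n "Suc k" k] pre_nth[of "Suc k" n k] pre_len[of "Suc k"]
    by (cases "n \<le> Suc k") (auto simp: flat_def)
  have flat_in: "\<exists>i. flat k \<in> set (ts (N + i))" for k
  proof -
    have "k < length (pre (Suc k))" using pre_len[of "Suc k"] by simp
    then have "flat k \<in> set (pre (Suc k))" by (simp add: flat_def)
    then show ?thesis using pre_set by blast
  qed
  have in_flat: "\<exists>k\<ge>i. t = flat k" if t: "t \<in> set (ts (N + i))" for i t
  proof -
    obtain p where p: "p < length (ts (N + i))" "ts (N + i) ! p = t" using t by (auto simp: in_set_conv_nth)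
    let ?k = "length (pre i) + p"
    have "pre (Suc i) ! ?k = t" "?k < length (pre (Suc i))" using p by (simp_all add: pre_Suc nth_append)
    then have "t = flat ?k" using flat by metis
    then show ?thesis using pre_len[of i] trans_le_add1 by blast
  qed
  have "valid (Node b flat)"
    unfolding valid.simps
  proof (intro conjI allI impI)
    show "valid (flat k)" for k using flat_in ts(1) by blast
    show "sep b (carrier (flat i)) (carrier (flat j))" if "i < j" for i j
      using sorted_wrt_nth_less[OF pre_sorted, of i j "Suc j"] that pre_len[of "Suc j"] flat[of i "Suc j"] flat[of j "Suc j"]
      by auto
    show "\<exists>j\<ge>n. emb (carrier (flat i)) (carrier (flat j))" for i n
    proof -
      have "rcr (flat i)" using flat_in N le_add1 by blast
      then obtain m t where m: "m \<ge> N + n" "t \<in> set (ts m)" "emb (carrier (flat i)) (carrier t)"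
        unfolding rcr_def by blast
      then obtain k where "k \<ge> m - N" "t = flat k" using in_flat[of t "m - N"] by auto
      then show ?thesis using m by (intro exI[of _ k]) auto
    qed
  qed
  moreover have "carrier (Node b flat) = (\<Union>i\<in>{N..}. A i)"
  proof
    show "carrier (Node b flat) \<subseteq> (\<Union>i\<in>{N..}. A i)"
    proof
      fix x assume "x \<in> carrier (Node b flat)"
      then obtain k where k: "x \<in> carrier (flat k)" by auto
      obtain i where "flat k \<in> set (ts (N + i))" using flat_in by blast
      then have "x \<in> A (N + i)" using k ts(3) by blast
      then show "x \<in> (\<Union>i\<in>{N..}. A i)" by auto
    qed
    show "(\<Union>i\<in>{N..}. A i) \<subseteq> carrier (Node b flat)"
    proof clarify
      fix x i assume "x \<in> A i" "i \<ge> N"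
      then obtain t where "t \<in> set (ts (N + (i - N)))" "x \<in> carrier t" using ts(3)[of i] by auto
      then show "x \<in> carrier (Node b flat)" using in_flat by (metis UN_I UNIV_I carrier.simps(2))
    qed
  qed
  ultimately have tail: "fin_decomp (\<Union>i\<in>{N..}. A i)" using fin_decomp_carrier by metis
  have "fin_decomp (\<Union>i<n. A i)" for n
  proof (induction n)
    case (Suc n)
    have "sep b (\<Union>i<n. A i) (A n)" using sep by (auto simp: sep_def)
    then show ?case using fin_decomp_Un[OF Suc fd] by (simp add: lessThan_Suc Un_commute)
  qed simp
  moreover have "sep b (\<Union>i<N. A i) (\<Union>i\<in>{N..}. A i)"
    unfolding sep_def
  proof (clarsimp)
    fix x y i j assume "x \<in> A i" "i < N" "y \<in> A j" "N \<le> j"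
    then show "lt b x y" using sepD[OF sep[of i j]] by simp
  qed
  ultimately have "fin_decomp ((\<Union>i<N. A i) \<union> (\<Union>i\<in>{N..}. A i))" using tail fin_decomp_Un by blast
  moreover have "(\<Union>i<N. A i) \<union> (\<Union>i\<in>{N..}. A i) = (\<Union>i. A i)"
    by auto (meson atLeast_iff lessThan_iff not_le_imp_less)
  ultimately show ?thesis by simp
qed

definition convex_in :: "'a::linorder set \<Rightarrow> 'a set \<Rightarrow> bool" where
  "convex_in L C \<longleftrightarrow> C \<subseteq> L \<and> (\<forall>a\<in>C. \<forall>b\<in>C. \<forall>z\<in>L. a \<le> z \<and> z \<le> b \<longrightarrow> z \<in> C)"

text \<open>The relation of Hausdorff's condensation.\<close>

definition close_in :: "'a::linorder set \<Rightarrow> 'a \<Rightarrow> 'a \<Rightarrow> bool" where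
  "close_in L x y \<longleftrightarrow> (\<forall>C. convex_in L C \<and> C \<subseteq> {min x y..max x y} \<longrightarrow> fin_decomp C)"

lemma convex_in_lt:
  "convex_in L C \<Longrightarrow> convex_in L {y \<in> C. lt b x y}"
  unfolding convex_in_def lt_def by (cases b) auto

lemma fin_decomp_half:
  assumes L: "countable L" and C: "convex_in L C" and cl: "\<And>x y. x \<in> C \<Longrightarrow> y \<in> C \<Longrightarrow> close_in L x y"
    and x: "x \<in> C"
  shows "fin_decomp {y \<in> C. lt b x y}"
proof -
  define D where "D = {y \<in> C. lt b x y}"
  have D: "convex_in L D" unfolding D_def using C by (rule convex_in_lt)
  have "fin_decomp D"
  proof (cases "\<exists>y\<in>D. \<forall>z\<in>D. \<not> lt b y z")
    case True
    then obtain y where y: "y \<in> D" "\<And>z. z \<in> D \<Longrightarrow> \<not> lt b y z" by blast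
    have "D \<subseteq> {min x y..max x y}"
    proof
      fix z assume z: "z \<in> D"
      then have "lt b x z" "\<not> lt b y z" using y by (auto simp: D_def)
      then show "z \<in> {min x y..max x y}" by (cases b) (auto simp: lt_def)
    qed
    then show ?thesis using cl[OF x, of y] y(1) D unfolding close_in_def D_def by blast
  next
    case False
    show ?thesis
    proof (cases "D = {}")
      case ne: False
      have "countable D" using C L by (auto simp: D_def convex_in_def intro: countable_subset)
      define d where "d = from_nat_into D"
      have rng: "range d = D" unfolding d_def using ne \<open>countable D\<close> by (rule range_from_nat_into)
      have "\<exists>p. \<forall>n :: nat. ((p n = x \<or> p n \<in> D) \<and> (n = 0 \<longrightarrow> p n = x)) \<and> (lt b (p n) (p (Suc n)) \<and> lt b (d n) (p (Suc n)))"
      proof (rule dependent_nat_choice)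
        fix p and n :: nat assume p: "(p = x \<or> p \<in> D) \<and> (n = 0 \<longrightarrow> p = x)"
        define e where "e = (if lt b p (d n) then d n else p)"
        have dn: "d n \<in> D" using rng by blast
        have "e \<in> D" using p dn by (auto simp: e_def D_def)
        then obtain q where "q \<in> D" "lt b e q" using False by blast
        moreover have "p = e \<or> lt b p e" "d n = e \<or> lt b (d n) e"
          using lt_linear[of p "d n" b] by (auto simp: e_def)
        ultimately show "\<exists>q. ((q = x \<or> q \<in> D) \<and> (Suc n = 0 \<longrightarrow> q = x)) \<and> lt b p q \<and> lt b (d n) q"
          using lt_trans by blast
      qed simp
      then obtain p where p: "\<forall>n :: nat. ((p n = x \<or> p n \<in> D) \<and> (n = 0 \<longrightarrow> p n = x)) \<and>
          (lt b (p n) (p (Suc n)) \<and> lt b (d n) (p (Suc n)))" ..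
      have p: "p n = x \<or> p n \<in> D" "p 0 = x" "lt b (p n) (p (Suc n))" "lt b (d n) (p (Suc n))" for n
        using spec[OF p, of n] spec[OF p, of 0] by simp_all
      have p_lt: "lt b (p i) (p j)" if "i < j" for i j
        using lt_chain[of b p, OF p(3) that] .
      have pC: "p n \<in> C" for n using p(1)[of n] x by (auto simp: D_def)
      define A where "A i = {y \<in> C. lt b (p i) y \<and> \<not> lt b (p (Suc i)) y}" for i
      have "fin_decomp (\<Union>i. A i)"
      proof (rule fin_decomp_sum)
        fix i
        have "convex_in L (A i)"
          using C unfolding convex_in_def A_def lt_def by (cases b) (auto simp: not_less)
        moreover have "A i \<subseteq> {min (p i) (p (Suc i))..max (p i) (p (Suc i))}"
          by (cases b) (auto simp: A_def lt_def)
        ultimately show "fin_decomp (A i)" using cl[OF pC pC] unfolding close_in_def by blast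
        have "p (Suc i) \<in> A i" using pC p(3) by (simp add: A_def)
        then show "A i \<noteq> {}" by blast
      next
        fix i j :: nat assume "i < j"
        then have "Suc i = j \<or> Suc i < j" by auto
        then have pij: "p (Suc i) = p j \<or> lt b (p (Suc i)) (p j)" using p_lt by blast
        show "sep b (A i) (A j)"
          unfolding sep_def
        proof (intro ballI)
          fix y z assume "y \<in> A i" "z \<in> A j"
          then have "y = p (Suc i) \<or> lt b y (p (Suc i))" "lt b (p j) z"
            using lt_linear[of y "p (Suc i)" b] by (auto simp: A_def)
          then show "lt b y z" using pij lt_trans by metis
        qed
      qed
      moreover have "(\<Union>i. A i) = D"
      proof
        show "(\<Union>i. A i) \<subseteq> D"
        proof clarify
          fix y i assume y: "y \<in> A i"
          have "x = p i \<or> lt b x (p i)" using p(1)[of i] by (auto simp: D_def)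
          then show "y \<in> D" using y lt_trans by (auto simp: A_def D_def)
        qed
        show "D \<subseteq> (\<Union>i. A i)"
        proof
          fix y assume y: "y \<in> D"
          then obtain n where "y = d n" using rng by blast
          then have ex: "lt b y (p (Suc n))" using p(4) by simp
          define k where "k = (LEAST k. lt b y (p k))"
          have k: "lt b y (p k)" unfolding k_def using ex by (rule LeastI)
          then have "k \<noteq> 0" using y p(2) lt_asym by (cases "k = 0") (auto simp: D_def)
          then obtain i where i: "k = Suc i" by (cases k) auto
          have "\<not> lt b y (p i)" using not_less_Least[of i "\<lambda>k. lt b y (p k)"] i by (simp add: k_def)
          then consider "lt b (p i) y" | "y = p i" using lt_linear by blast
          then show "y \<in> (\<Union>i. A i)"
          proof cases
            case 1
            then have "y \<in> A i" using k i y lt_asym by (auto simp: A_def D_def)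
            then show ?thesis by blast
          next
            case 2
            then obtain j where "i = Suc j" using y p(2) by (cases i) (auto simp: D_def)
            then have "y \<in> A j" using 2 p(3) pC by (auto simp: A_def)
            then show ?thesis by blast
          qed
        qed
      qed
      ultimately show ?thesis by simp
    qed simp
  qed
  then show ?thesis by (simp add: D_def)
qed

lemma fin_decomp_close:
  assumes L: "countable L" and C: "convex_in L C" and cl: "\<And>x y. x \<in> C \<Longrightarrow> y \<in> C \<Longrightarrow> close_in L x y"
  shows "fin_decomp C"
proof (cases "C = {}")
  case False
  then obtain x where x: "x \<in> C" by blast
  let ?D = "\<lambda>b. {y \<in> C. lt b x y}"
  have D: "fin_decomp (?D b)" for b using fin_decomp_half[OF L C cl x] by blast
  have "fin_decomp ({x} \<union> ?D True)"
    by (rule fin_decomp_Un[where b = True]) (use D in \<open>auto simp: sep_def\<close>)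
  then have "fin_decomp (?D False \<union> ({x} \<union> ?D True))"
    by (rule fin_decomp_Un[where b = True, OF D]) (auto simp: sep_def lt_def)
  moreover have "?D False \<union> ({x} \<union> ?D True) = C" using x by (auto simp: lt_def)
  ultimately show ?thesis by simp
qed simp

lemma close_in_mono:
  assumes "close_in L x y" "min x y \<le> min u v" "max u v \<le> max x y"
  shows "close_in L u v"
  using assms unfolding close_in_def by (meson atLeastatMost_subset_iff subset_trans)

theorem scattered_fin_decomp:
  assumes L: "countable L" "scattered_set L"
  shows "fin_decomp L"
proof (rule ccontr)
  assume no: "\<not> fin_decomp L"
  define P where "P x y \<longleftrightarrow> x \<in> L \<and> y \<in> L \<and> x < y \<and> \<not> close_in L x y" for x y
  have "convex_in L L" by (simp add: convex_in_def)
  then obtain x0 y0 where xy: "x0 \<in> L" "y0 \<in> L" "\<not> close_in L x0 y0"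
    using no fin_decomp_close[OF L(1)] by blast
  have sym: "close_in L x y = close_in L y x" for x y
    by (simp add: close_in_def min.commute max.commute)
  have self: "close_in L x x" if "x \<in> L" for x
    unfolding close_in_def by (auto dest!: subset_singletonD)
  have "\<not> scattered_set L"
  proof (rule not_scattered_if_split[where P = P])
    show "P (min x0 y0) (max x0 y0)"
      using xy sym self by (auto simp: P_def min_def max_def order.order_iff_strict)
    show "x \<in> L \<and> y \<in> L \<and> x < y" if "P x y" for x y using that by (simp add: P_def)
    show "P x' y'" if P: "P x y" and le: "x' \<in> L" "y' \<in> L" "x' \<le> x" "y \<le> y'" for x y x' y'
    proof -
      have "x' < y'" "x < y" using P le by (auto simp: P_def)
      then have "\<not> close_in L x' y'" using P le close_in_mono[of L x' y' x y] by (auto simp: P_def)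
      then show ?thesis using le \<open>x' < y'\<close> by (simp add: P_def)
    qed
    show "\<exists>z. P x z \<and> P z y" if P: "P x y" for x y
    proof (rule ccontr)
      assume none: "\<nexists>z. P x z \<and> P z y"
      have xy: "x \<in> L" "y \<in> L" "x < y" using P by (auto simp: P_def)
      have cases: "close_in L x z \<or> close_in L z y" if "z \<in> L" "x \<le> z" "z \<le> y" for z
        using that none self xy unfolding P_def by (metis order.order_iff_strict)
      have "close_in L x y"
        unfolding close_in_def
      proof (intro allI impI, elim conjE)
        fix C assume C: "convex_in L C" "C \<subseteq> {min x y..max x y}"
        then have CL: "C \<subseteq> L" and Cxy: "\<And>z. z \<in> C \<Longrightarrow> x \<le> z \<and> z \<le> y" using xy by (auto simp: convex_in_def)
        let ?K = "{z \<in> C. close_in L x z}" and ?M = "{z \<in> C. \<not> close_in L x z}"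
        have below: "close_in L x z" if "close_in L x w" "x \<le> z" "z \<le> w" for z w
          using close_in_mono[OF that(1), of x z] that by auto
        have conv: "convex_in L ?K" "convex_in L ?M"
          using C(1) Cxy below unfolding convex_in_def by blast+
        have "fin_decomp ?K"
        proof (rule fin_decomp_close[OF L(1) conv(1)])
          fix u v assume "u \<in> ?K" "v \<in> ?K"
          then show "close_in L u v" using Cxy close_in_mono[of L x "max u v" u v] by (auto simp: max_def split: if_splits)
        qed
        moreover have "fin_decomp ?M"
        proof (rule fin_decomp_close[OF L(1) conv(2)])
          fix u v assume uv: "u \<in> ?M" "v \<in> ?M"
          then have "close_in L u y" "close_in L v y" using cases CL Cxy by blast+
          then show "close_in L u v" using uv Cxy close_in_mono[of L "min u v" y u v] by (auto simp: min_def split: if_splits)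
        qed
        moreover have "sep True ?K ?M"
          using below Cxy by (auto simp: sep_def lt_def) (meson not_le)
        ultimately have "fin_decomp (?K \<union> ?M)" by (rule fin_decomp_Un)
        moreover have "?K \<union> ?M = C" by blast
        ultimately show "fin_decomp C" by simp
      qed
      then show False using P by (simp add: P_def)
    qed
  qed
  then show False using L(2) by blast
qed

section \<open>Copies inside a minimal decomposition\<close>

definition min_decomp :: "'a::linorder htree list \<Rightarrow> 'a set \<Rightarrow> bool" where
  "min_decomp ts A \<longleftrightarrow> decomp ts A \<and> (\<forall>us. decomp us A \<longrightarrow> length ts \<le> length us)"

lemma ex_min_decomp:
  assumes "countable L" "scattered_set L"
  shows "\<exists>ts. min_decomp ts L"
  using ex_has_least_nat[of "\<lambda>ts. decomp ts L" _ length] scattered_fin_decomp[OF assms]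
  unfolding min_decomp_def fin_decomp_def by blast

lemma decomp_nth:
  assumes "decomp ts L"
  shows "i < length ts \<Longrightarrow> valid (ts ! i)"
    and "i < length ts \<Longrightarrow> carrier (ts ! i) \<subseteq> L"
    and "i < j \<Longrightarrow> j < length ts \<Longrightarrow> sep True (carrier (ts ! i)) (carrier (ts ! j))"
    and "L = (\<Union>i<length ts. carrier (ts ! i))"
proof -
  have L: "L = (\<Union>t\<in>set ts. carrier t)" using assms by (simp add: decomp_def)
  show "i < length ts \<Longrightarrow> valid (ts ! i)" using assms by (simp add: decomp_def)
  show "i < length ts \<Longrightarrow> carrier (ts ! i) \<subseteq> L" using L by auto
  show "i < j \<Longrightarrow> j < length ts \<Longrightarrow> sep True (carrier (ts ! i)) (carrier (ts ! j))"
    using assms by (simp add: decomp_def sorted_wrt_iff_nth_less)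
  have "set ts = (!) ts ` {..<length ts}" by (auto simp: in_set_conv_nth)
  then show "L = (\<Union>i<length ts. carrier (ts ! i))" using L by simp
qed

lemma min_decomp_no_merge:
  assumes ts: "min_decomp ts L" and p: "Suc p < length ts"
    and V: "valid V" "carrier V = carrier (ts ! p) \<union> carrier (ts ! Suc p)"
  shows False
proof -
  obtain xs s t ys where ts_eq: "ts = xs @ s # t # ys" and "length xs = p"
    using p id_take_nth_drop[of p ts] by (metis Cons_nth_drop_Suc Suc_lessD length_take min.absorb4)
  then have V': "carrier V = carrier s \<union> carrier t"
    using V(2) by (simp add: nth_append)
  have "decomp (xs @ V # ys) L"
    using ts V(1) unfolding min_decomp_def decomp_def ts_eq
    by (auto simp: sorted_wrt_append V' sep_def)
  then have "length ts \<le> length (xs @ V # ys)" using ts by (auto simp: min_decomp_def)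
  then show False by (simp add: ts_eq)
qed

text \<open>The map sends a final part of the block \<open>p\<close> (an initial part, if the block is an \<open>\<omega>\<close>*-sum) into a single
  block \<open>\<phi> p\<close>, and \<open>\<phi>\<close> is monotone. Next to the first \<open>p\<close> with \<open>\<phi> p < p\<close>, or the last one with \<open>p < \<phi> p\<close>, two
  adjacent blocks are sent into one of them, so they merge, against minimality.\<close>

lemma core_fixed:
  assumes ts: "min_decomp ts L" and L: "scattered_set L"
    and f: "strict_mono_on L f" "f ` L \<subseteq> L" and p: "p < length ts"
  shows "\<exists>a\<in>carrier (ts ! p). f ` tail (ts ! p) a \<subseteq> carrier (ts ! p)"
proof -
  let ?A = "\<lambda>i. carrier (ts ! i)" and ?k = "length ts"
  have dec: "decomp ts L" using ts by (simp add: min_decomp_def)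
  note nth = decomp_nth[OF dec]
  have "\<exists>i<?k. \<exists>a\<in>?A p. f ` tail (ts ! p) a \<subseteq> ?A i" if "p < ?k" for p
  proof (rule core_exists[where c = True])
    show "strict_mono_on (?A p) f" using f(1) nth(2)[OF that] by (rule monotone_on_subset)
    show "f ` ?A p \<subseteq> (\<Union>i<?k. ?A i)"
      unfolding nth(4)[symmetric] using f(2) nth(2)[OF that] by blast
  qed (rule nth(3))
  then obtain \<phi> a where \<phi>: "\<And>p. p < ?k \<Longrightarrow> \<phi> p < ?k"
    and a: "\<And>p. p < ?k \<Longrightarrow> a p \<in> ?A p" "\<And>p. p < ?k \<Longrightarrow> f ` tail (ts ! p) (a p) \<subseteq> ?A (\<phi> p)" by metis
  have fa: "f (a p) \<in> ?A (\<phi> p)" if "p < ?k" for p using a[OF that] tail_self by blast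
  have mono: "\<phi> p \<le> \<phi> q" if "p < q" "q < ?k" for p q
  proof (rule ccontr)
    assume "\<not> \<phi> p \<le> \<phi> q"
    then have gt: "f (a q) < f (a p)"
      using sepD[OF nth(3), of "\<phi> q" "\<phi> p"] fa that \<phi> by (auto simp: lt_def)
    moreover have "a p < a q" using sepD[OF nth(3), of p q] a(1) that by (auto simp: lt_def)
    moreover have "a p \<in> L" "a q \<in> L" using a(1) nth(2) that by (meson order_less_trans subsetD)+
    ultimately have "f (a p) < f (a q)" using f(1) by (simp add: strict_mono_on_def)
    then show False using gt by simp
  qed
  have merge: "\<exists>V. valid V \<and> carrier V = ?A p \<union> ?A q"
    if pq: "p < ?k" "q < ?k" "sep c (?A p) (?A q)" and "\<phi> p = p" "\<phi> q = p" for p q c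
  proof (rule collapse_merge[OF nth(1)[OF pq(1)] nth(1)[OF pq(2)] nth(2)[OF pq(1)] L pq(3)])
    show "strict_mono_on (?A p \<union> ?A q) f"
      using f(1) by (rule monotone_on_subset) (use nth(2) pq in blast)
    show "a p \<in> ?A p" "a q \<in> ?A q" using a(1) pq by simp_all
    show "f ` tail (ts ! p) (a p) \<subseteq> ?A p" "f ` tail (ts ! q) (a q) \<subseteq> ?A p"
      using a(2)[OF pq(1)] a(2)[OF pq(2)] that(4,5) by simp_all
  qed
  have "\<not> \<phi> p < p" if "p < ?k" for p
  proof
    assume "\<phi> p < p"
    define m where "m = (LEAST m. m < ?k \<and> \<phi> m < m)"
    have m: "m < ?k" "\<phi> m < m"
      using LeastI[of "\<lambda>m. m < ?k \<and> \<phi> m < m" p] that \<open>\<phi> p < p\<close> by (auto simp: m_def)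
    then obtain n where n: "m = Suc n" by (cases m) auto
    have "\<not> \<phi> n < n" using not_less_Least[of n "\<lambda>m. m < ?k \<and> \<phi> m < m"] n m by (auto simp: m_def)
    then have "\<phi> n = n" "\<phi> m = n" using m mono[of n m] n by auto
    moreover have "sep True (?A n) (?A m)" using nth(3) n m by simp
    ultimately show False using merge[of n m True] m n min_decomp_no_merge[OF ts, of n] by auto
  qed
  moreover have "\<not> p < \<phi> p" if "p < ?k" for p
  proof
    assume "p < \<phi> p"
    define m where "m = Max {m. m < ?k \<and> m < \<phi> m}"
    have "m \<in> {m. m < ?k \<and> m < \<phi> m}"
      unfolding m_def by (rule Max_in) (use that \<open>p < \<phi> p\<close> in auto)
    then have m: "m < ?k" "m < \<phi> m" by auto
    have k: "Suc m < ?k" using m \<phi>[OF m(1)] by simp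
    have "\<not> Suc m < \<phi> (Suc m)"
    proof
      assume "Suc m < \<phi> (Suc m)"
      then have "Suc m \<le> m" using k unfolding m_def by (intro Max_ge) auto
      then show False by simp
    qed
    then have "\<phi> (Suc m) = Suc m" "\<phi> m = Suc m" using m mono[of m "Suc m"] k by auto
    moreover have "sep False (?A (Suc m)) (?A m)" using nth(3)[of m "Suc m"] k by (simp add: sep_False)
    ultimately show False
      using merge[of "Suc m" m False] m k min_decomp_no_merge[OF ts k] by (auto simp: Un_commute)
  qed
  ultimately have "\<phi> p = p" using p by (meson linorder_neqE_nat)
  then show ?thesis using a p by metis
qed

lemma emb_block:
  assumes ts: "min_decomp ts L" and L: "scattered_set L"
    and C: "emb L C" "C \<subseteq> L" and p: "p < length ts"
  shows "emb (carrier (ts ! p)) (C \<inter> carrier (ts ! p))"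
proof -
  obtain f where f: "strict_mono_on L f" "f ` L \<subseteq> C" using C(1) by (auto simp: emb_def)
  have dec: "decomp ts L" using ts by (simp add: min_decomp_def)
  obtain a where a: "a \<in> carrier (ts ! p)" "f ` tail (ts ! p) a \<subseteq> carrier (ts ! p)"
    using core_fixed[OF ts L f(1) _ p] f(2) C(2) by blast
  have "tail (ts ! p) a \<subseteq> L" using tail_subset decomp_nth(2)[OF dec p] by blast
  then have "emb (tail (ts ! p) a) (C \<inter> carrier (ts ! p))"
    using a f by (intro emb_image[OF monotone_on_subset[OF f(1)]]) auto
  then show ?thesis using emb_tail[OF decomp_nth(1)[OF dec p] a(1)] emb_trans by blast
qed

lemma emb_of_blocks:
  assumes dec: "decomp ts L" and emb: "\<And>p. p < length ts \<Longrightarrow> emb (carrier (ts ! p)) (C \<inter> carrier (ts ! p))"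
  shows "emb L C"
proof -
  note nth = decomp_nth[OF dec]
  have "emb (\<Union>p\<in>{..<length ts}. carrier (ts ! p)) (\<Union>p\<in>{..<length ts}. C \<inter> carrier (ts ! p))"
    by (rule emb_UN[where b = True]) (use emb nth(3) in \<open>auto intro: sep_mono\<close>)
  then show ?thesis using nth(4) by (auto intro: emb_mono)
qed

lemma emb_Int_tail:
  assumes T: "valid T" and L: "carrier T \<subseteq> L" "scattered_set L"
    and X: "emb (carrier T) X" "X \<subseteq> carrier T" and c: "c \<in> carrier T"
  shows "emb (carrier T) (X \<inter> tail T c)"
proof -
  obtain h where h: "strict_mono_on (carrier T) h" "h ` carrier T \<subseteq> X" using X(1) by (auto simp: emb_def)
  have "\<exists>x\<in>carrier T. h x \<in> tail T c"
  proof (cases T)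
    case (Leaf x)
    then show ?thesis using h X c by (auto simp: tail_def)
  next
    case (Node b ts)
    show ?thesis
    proof (rule ccontr)
      assume "\<not> ?thesis"
      then have "h ` carrier T \<subseteq> {y \<in> carrier T. lt b y c}"
        using h(2) X(2) Node lt_linear[of _ c b] by (force simp: tail_def)
      then show False using not_emb_below[of b ts L c] emb_image[OF h(1)] T L c Node by metis
    qed
  qed
  then obtain x where x: "x \<in> carrier T" "h x \<in> tail T c" by blast
  have "h ` tail T x \<subseteq> X \<inter> tail T c"
  proof clarify
    fix y assume y: "y \<in> tail T x"
    then have yT: "y \<in> carrier T" using tail_subset by blast
    have "y = x \<or> lt (dir T) (h x) (h y)"
      using y strict_mono_on_lt[OF h(1) x(1) yT] by (auto simp: tail_def)
    moreover have "h x = c \<or> lt (dir T) c (h x)" using x(2) by (simp add: tail_def)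
    ultimately have "h y = c \<or> lt (dir T) c (h y)" using lt_trans by metis
    then show "h y \<in> X \<inter> tail T c"
      using h(2) yT X(2) by (auto simp: tail_def)
  qed
  then have "emb (tail T x) (X \<inter> tail T c)"
    by (intro emb_image[OF monotone_on_subset[OF h(1) tail_subset]])
  then show ?thesis using emb_tail[OF T x(1)] emb_trans by blast
qed

lemma block_pseudo_intersection:
  assumes T: "valid T" and L: "carrier T \<subseteq> L" "scattered_set L"
    and B: "decseq B" "\<And>n. emb (carrier T) (B n \<inter> carrier T)"
  shows "\<exists>q\<subseteq>carrier T. emb (carrier T) q \<and> (\<forall>n. \<exists>c\<in>carrier T. q \<inter> tail T c \<subseteq> B n)"
proof (cases T)
  case (Leaf x)
  have "x \<in> B n" for n using B(2)[of n] Leaf by (auto simp: emb_def)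
  then show ?thesis using Leaf by (intro exI[of _ "{x}"]) (auto intro: emb_subset)
next
  case (Node b ts)
  let ?A = "carrier T"
  define step where "step m c p \<longleftrightarrow> (c \<in> ?A \<longrightarrow> fst p \<subseteq> B m \<inter> tail T c \<and> emb (carrier (ts m)) (fst p) \<and>
      snd p \<in> ?A \<and> (\<forall>y\<in>fst p. lt b y (snd p)))" for m c p
  have "\<exists>p. step m c p" for m c
  proof (cases "c \<in> ?A")
    case True
    have "emb ?A (B m \<inter> ?A \<inter> tail T c)"
      using emb_Int_tail[OF T L B(2) _ True] by simp
    then obtain h where h: "strict_mono_on ?A h" "h ` ?A \<subseteq> B m \<inter> ?A \<inter> tail T c" by (auto simp: emb_def)
    obtain y where y: "y \<in> carrier (ts (Suc m))" using carrier_nonempty[of "ts (Suc m)"] by blast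
    then have yA: "y \<in> ?A" using Node by auto
    have sub: "carrier (ts m) \<subseteq> ?A" using Node by auto
    have "sep b (carrier (ts m)) (carrier (ts (Suc m)))" using T Node by simp
    then have "\<forall>z\<in>h ` carrier (ts m). lt b z (h y)"
      using strict_mono_on_lt[OF h(1)] sub yA y sepD by blast
    moreover have "h ` carrier (ts m) \<subseteq> B m \<inter> tail T c" "h y \<in> ?A" using h(2) sub yA by blast+
    moreover have "emb (carrier (ts m)) (h ` carrier (ts m))"
      using monotone_on_subset[OF h(1) sub] by (rule emb_image) simp
    ultimately show ?thesis by (intro exI[of _ "(h ` carrier (ts m), h y)"]) (simp add: step_def)
  qed (simp add: step_def)
  then obtain W where W: "\<And>m c. step m c (W m c)" by metis
  define Q nx where "Q m c = fst (W m c)" and "nx m c = snd (W m c)" for m c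
  have Q: "\<And>m c. c \<in> ?A \<Longrightarrow> Q m c \<subseteq> B m \<inter> tail T c"
      "\<And>m c. c \<in> ?A \<Longrightarrow> emb (carrier (ts m)) (Q m c)"
      "\<And>m c. c \<in> ?A \<Longrightarrow> nx m c \<in> ?A" "\<And>m c y. c \<in> ?A \<Longrightarrow> y \<in> Q m c \<Longrightarrow> lt b y (nx m c)"
    using W by (simp_all add: step_def Q_def nx_def)
  obtain c0 where c0: "c0 \<in> ?A" using carrier_nonempty[of T] by blast
  define c where "c = rec_nat c0 nx"
  have c_Suc: "c (Suc m) = nx m (c m)" for m by (simp add: c_def)
  have cA: "c m \<in> ?A" for m by (induction m) (use c0 Q(3) in \<open>auto simp: c_def\<close>)
  define R where "R m = Q m (c m)" for m
  have R: "R m \<subseteq> B m \<inter> tail T (c m)" "emb (carrier (ts m)) (R m)" "y \<in> R m \<Longrightarrow> lt b y (c (Suc m))" for m y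
    using Q cA by (simp_all add: R_def c_Suc)
  have dir: "dir T = b" using Node by simp
  have "lt b (c m) (c (Suc m))" for m
  proof -
    obtain y where y: "y \<in> R m" using R(2)[of m] carrier_nonempty[of "ts m"] by (fastforce simp: emb_def)
    then have "y = c m \<or> lt b (c m) y" using R(1) dir by (auto simp: tail_def)
    then show ?thesis using R(3)[OF y] lt_trans by blast
  qed
  then have "lt b (c i) (c j)" if "i < j" for i j using lt_chain that by blast
  then have R_lt: "lt b y (c j)" if "y \<in> R i" "i < j" for i j y
    using R(3)[OF that(1)] that(2) lt_trans by (metis Suc_lessI)
  have "emb (\<Union>i\<in>UNIV. carrier (ts i)) (\<Union>i\<in>UNIV. R i)"
  proof (rule emb_UN[where b = b])
    show "sep b (R i) (R j)" if "i < j" for i j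
      unfolding sep_def
    proof (intro ballI)
      fix y z assume "y \<in> R i" "z \<in> R j"
      moreover from this have "z = c j \<or> lt b (c j) z" using R(1) dir by (auto simp: tail_def)
      ultimately show "lt b y z" using R_lt that lt_trans by blast
    qed
  qed (use R(2) T Node in auto)
  moreover have "(\<Union>i. R i) \<subseteq> ?A" using R(1) tail_subset by blast
  moreover have "(\<Union>i. R i) \<inter> tail T (c n) \<subseteq> B n" for n
  proof clarify
    fix y i assume y: "y \<in> R i" "y \<in> tail T (c n)"
    have "\<not> i < n"
    proof
      assume "i < n"
      then have "lt b y (c n)" using R_lt y by blast
      then show False using y(2) dir lt_asym by (auto simp: tail_def)
    qed
    then have "B i \<subseteq> B n" using B(1) by (simp add: decseq_def)
    then show "y \<in> B n" using R(1) y(1) by blast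
  qed
  moreover have "?A = (\<Union>i. carrier (ts i))" using Node by simp
  ultimately show ?thesis using cA by metis
qed

theorem pseudo_intersection:
  assumes L: "countable L" "scattered_set L"
    and B: "decseq B" "\<And>n. B n \<subseteq> L" "\<And>n. emb L (B n)"
  shows "\<exists>q\<subseteq>L. emb L q \<and> (\<forall>n C. C \<subseteq> q \<and> emb L C \<longrightarrow> emb L (C \<inter> B n))"
proof -
  obtain ts where ts: "min_decomp ts L" using ex_min_decomp[OF L] by blast
  then have dec: "decomp ts L" by (simp add: min_decomp_def)
  note nth = decomp_nth[OF dec]
  let ?A = "\<lambda>p. carrier (ts ! p)" and ?k = "length ts"
  have "\<exists>q\<subseteq>?A p. emb (?A p) q \<and> (\<forall>n. \<exists>c\<in>?A p. q \<inter> tail (ts ! p) c \<subseteq> B n)" if "p < ?k" for p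
    using emb_block[OF ts L(2) B(3) B(2) that]
    by (intro block_pseudo_intersection[OF nth(1)[OF that] nth(2)[OF that] L(2) B(1)])
  then obtain q where q: "\<And>p. p < ?k \<Longrightarrow> q p \<subseteq> ?A p" "\<And>p. p < ?k \<Longrightarrow> emb (?A p) (q p)"
    "\<And>p n. p < ?k \<Longrightarrow> \<exists>c\<in>?A p. q p \<inter> tail (ts ! p) c \<subseteq> B n" by metis
  define Q where "Q = (\<Union>p<?k. q p)"
  have QL: "Q \<subseteq> L" using q(1) nth(2) by (fastforce simp: Q_def)
  have Qq: "Q \<inter> ?A p = q p" if "p < ?k" for p
  proof -
    have "x \<in> q p" if x: "x \<in> q i" "i < ?k" "x \<in> ?A p" for x i
    proof -
      have "\<not> i < p" "\<not> p < i"
        using x q(1)[OF x(2)] \<open>p < ?k\<close> sepD[OF nth(3), of i p x x] sepD[OF nth(3), of p i x x] by auto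
      then show ?thesis using x by (metis linorder_neqE_nat)
    qed
    then show ?thesis using q(1)[OF that] that by (auto simp: Q_def)
  qed
  have "emb L Q" by (rule emb_of_blocks[OF dec]) (use Qq q(2) in simp)
  moreover have "emb L (C \<inter> B n)" if C: "C \<subseteq> Q" "emb L C" for n C
  proof (rule emb_of_blocks[OF dec])
    fix p assume p: "p < ?k"
    obtain c where c: "c \<in> ?A p" "q p \<inter> tail (ts ! p) c \<subseteq> B n" using q(3)[OF p] by blast
    have "emb (?A p) (C \<inter> ?A p \<inter> tail (ts ! p) c)"
      using emb_block[OF ts L(2) C(2) _ p] C(1) QL c(1)
      by (intro emb_Int_tail[OF nth(1)[OF p] nth(2)[OF p] L(2)]) auto
    then show "emb (?A p) (C \<inter> B n \<inter> ?A p)"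
      by (rule emb_mono) (use c(2) C(1) Qq[OF p] in auto)
  qed
  ultimately show ?thesis using QL by blast
qed

section \<open>Transfer to relations\<close>

lemma countable_linear_order_real:
  assumes lin: "linear_order_on L r" and L: "countable L"
  shows "\<exists>e :: 'a \<Rightarrow> real. \<forall>x\<in>L. \<forall>y\<in>L. (x, y) \<in> r \<longleftrightarrow> e x \<le> e y"
proof -
  have refl: "(x, x) \<in> r" if "x \<in> L" for x
    using lin that by (auto simp: order_on_defs refl_on_def)
  have trans: "(x, y) \<in> r \<Longrightarrow> (y, z) \<in> r \<Longrightarrow> (x, z) \<in> r" for x y z
    using lin by (auto simp: order_on_defs dest: transD)
  have anti: "(x, y) \<in> r \<Longrightarrow> (y, x) \<in> r \<Longrightarrow> x = y" for x y
    using lin by (auto simp: order_on_defs dest: antisymD)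
  have total: "(x, y) \<in> r \<or> (y, x) \<in> r" if "x \<in> L" "y \<in> L" for x y
    using lin that refl by (cases "x = y") (auto simp: order_on_defs total_on_def)
  define w where "w x n = (if \<exists>y\<in>L. to_nat_on L y = n \<and> (y, x) \<in> r \<and> y \<noteq> x then (1 / 2 :: real) ^ n else 0)" for x n
  have summ: "summable (w x)" for x
    by (rule summable_comparison_test'[of "\<lambda>n. (1 / 2 :: real) ^ n" 0])
      (auto simp: w_def intro: summable_geometric)
  define e where "e x = suminf (w x)" for x
  have less: "e x < e y" if x: "x \<in> L" and y: "y \<in> L" and xy: "(x, y) \<in> r" "x \<noteq> y" for x y
  proof -
    have sub: "(z, x) \<in> r \<and> z \<noteq> x \<Longrightarrow> (z, y) \<in> r \<and> z \<noteq> y" for z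
      using trans anti xy by blast
    have "0 \<le> w y n - w x n" for n using sub by (auto simp: w_def)
    moreover have "0 < w y (to_nat_on L x) - w x (to_nat_on L x)"
      using x xy inj_onD[OF inj_on_to_nat_on[OF L]] by (auto simp: w_def)
    ultimately have "0 < (\<Sum>n. w y n - w x n)"
      using suminf_pos2[OF summable_diff[OF summ summ]] by blast
    then show ?thesis by (simp add: e_def suminf_diff[OF summ summ, symmetric])
  qed
  have "(x, y) \<in> r \<longleftrightarrow> e x \<le> e y" if "x \<in> L" "y \<in> L" for x y
    using less[OF that] less[OF that(2,1)] total[OF that] refl[OF that(1)] by (metis less_imp_le not_le order_refl)
  then show ?thesis by blast
qed

lemma ex_copy_iff_emb:
  fixes e :: "'a \<Rightarrow> 'b::linorder"
  assumes lin: "linear_order_on L r"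
    and e: "\<And>x y. x \<in> L \<Longrightarrow> y \<in> L \<Longrightarrow> (x, y) \<in> r \<longleftrightarrow> e x \<le> e y"
    and X: "X \<subseteq> L"
  shows "(\<exists>D\<in>copies L r. D \<subseteq> X) \<longleftrightarrow> emb (e ` L) (e ` X)"
proof -
  have r: "r \<subseteq> L \<times> L" and refl: "\<And>x. x \<in> L \<Longrightarrow> (x, x) \<in> r"
    and anti: "\<And>x y. (x, y) \<in> r \<Longrightarrow> (y, x) \<in> r \<Longrightarrow> x = y"
    using lin by (auto simp: order_on_defs refl_on_def dest: antisymD)
  have inj: "inj_on e L" using e anti by (metis inj_onI order_refl)
  have Field: "Field (Restr r D) = D" if "D \<subseteq> L" for D
    using refl that by (auto simp: Field_def)
  have FieldL: "Field r = L" using Field[of L] r by (simp add: Int_absorb2)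
  show ?thesis
  proof
    assume "\<exists>D\<in>copies L r. D \<subseteq> X"
    then obtain D f where D: "D \<subseteq> X" "D \<subseteq> L" and "iso (Restr r D) r f" by (auto simp: copies_def)
    then have f: "bij_betw f D L" "\<And>a b. a \<in> D \<Longrightarrow> b \<in> D \<Longrightarrow> (a, b) \<in> r \<longleftrightarrow> (f a, f b) \<in> r"
      unfolding iso_iff2 using Field FieldL by auto
    define h where "h u = e (inv_into D f (inv_into L e u))" for u
    have h: "h (e x) = e (inv_into D f x)" if "x \<in> L" for x using inj that by (simp add: h_def)
    have g: "inv_into D f x \<in> D" "f (inv_into D f x) = x" if "x \<in> L" for x
      using f(1) that bij_betw_inv_into_right[OF f(1) that] by (auto simp: bij_betw_def intro: inv_into_into)
    have "e (inv_into D f x) < e (inv_into D f y)" if xy: "x \<in> L" "y \<in> L" "e x < e y" for x y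
    proof -
      have "\<not> (y, x) \<in> r" using e xy by auto
      then have "\<not> (inv_into D f y, inv_into D f x) \<in> r" using f(2) g xy by metis
      then show ?thesis using e g D(2) xy by (meson not_le subsetD)
    qed
    then have "strict_mono_on (e ` L) h" by (auto simp: strict_mono_on_def h)
    moreover have "h ` e ` L \<subseteq> e ` X"
    proof clarify
      fix x assume "x \<in> L"
      then show "h (e x) \<in> e ` X" using h g(1) D(1) by (metis imageI subsetD)
    qed
    ultimately show "emb (e ` L) (e ` X)" by (rule emb_image)
  next
    assume "emb (e ` L) (e ` X)"
    then obtain h where h: "strict_mono_on (e ` L) h" "h ` e ` L \<subseteq> e ` X" by (auto simp: emb_def)
    define k where "k x = inv_into X e (h (e x))" for x
    have k: "k x \<in> X" "e (k x) = h (e x)" if "x \<in> L" for x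
    proof -
      have hx: "h (e x) \<in> e ` X" using h(2) that by blast
      then show "k x \<in> X" "e (k x) = h (e x)"
        unfolding k_def by (rule inv_into_into, rule f_inv_into_f)
    qed
    have hle: "h (e x) \<le> h (e y) \<longleftrightarrow> e x \<le> e y" if "x \<in> L" "y \<in> L" for x y
      using strict_mono_on_leD[OF h(1), of "e x" "e y"] h(1) that
      unfolding strict_mono_on_def by (meson image_eqI leD not_le)
    have kr: "(k x, k y) \<in> r \<longleftrightarrow> (x, y) \<in> r" if "x \<in> L" "y \<in> L" for x y
      using e k X hle that by (metis subsetD)
    have kinj: "inj_on k L" using kr refl anti by (metis inj_onI)
    have "iso (Restr r (k ` L)) r (inv_into L k)"
      unfolding iso_iff2
    proof (intro conjI ballI)
      have kL: "k ` L \<subseteq> L" using k X by auto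
      show "bij_betw (inv_into L k) (Field (Restr r (k ` L))) (Field r)"
        unfolding Field[OF kL] FieldL by (rule bij_betw_inv_into) (use kinj in \<open>simp add: bij_betw_def\<close>)
      fix a b assume "a \<in> Field (Restr r (k ` L))" "b \<in> Field (Restr r (k ` L))"
      then show "(a, b) \<in> Restr r (k ` L) \<longleftrightarrow> (inv_into L k a, inv_into L k b) \<in> r"
        unfolding Field[OF kL] using kr kinj by auto
    qed
    then show "\<exists>D\<in>copies L r. D \<subseteq> X"
      using k X unfolding copies_def by (intro bexI[of _ "k ` L"]) auto
  qed
qed

theorem theorem6p6:
  fixes L :: "'a set" and r :: "'a rel"
  assumes "linear_order_on L r"
    and "countable L"
    and "scattered_on L r"
  shows "sigma_closed_on (copies L r) (sep_mod L r)"
  unfolding sigma_closed_on_def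
proof (intro allI impI)
  fix p :: "nat \<Rightarrow> 'a set"
  assume p: "\<forall>n. p n \<in> copies L r" and dec: "\<forall>n. (p (Suc n), p n) \<in> sep_mod L r"
  have sub: "D \<subseteq> L" if "D \<in> copies L r" for D using that by (simp add: copies_def)
  obtain e :: "'a \<Rightarrow> real" where e: "\<And>x y. x \<in> L \<Longrightarrow> y \<in> L \<Longrightarrow> (x, y) \<in> r \<longleftrightarrow> e x \<le> e y"
    using countable_linear_order_real[OF assms(1,2)] by blast
  have copy: "(\<exists>D\<in>copies L r. D \<subseteq> X) \<longleftrightarrow> emb (e ` L) (e ` X)" if "X \<subseteq> L" for X
    by (rule ex_copy_iff_emb[OF assms(1) _ that]) (rule e)
  have inj: "inj_on e L"
  proof (rule inj_onI)
    fix x y assume "x \<in> L" "y \<in> L" "e x = e y"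
    then have "(x, y) \<in> r" "(y, x) \<in> r" using e by simp_all
    then show "x = y" using assms(1) by (auto simp: order_on_defs dest: antisymD)
  qed
  have scat: "scattered_set (e ` L)"
    unfolding scattered_set_def
  proof
    assume "\<exists>f :: rat \<Rightarrow> real. strict_mono f \<and> range f \<subseteq> e ` L"
    then obtain f :: "rat \<Rightarrow> real" where f: "strict_mono f" "range f \<subseteq> e ` L" by blast
    have g: "inv_into L e (f q) \<in> L" "e (inv_into L e (f q)) = f q" for q
      using f(2) inv_into_into[of "f q" e L] f_inv_into_f[of "f q" e L] by blast+
    have "x \<le> y \<longleftrightarrow> (inv_into L e (f x), inv_into L e (f y)) \<in> r" for x y
      using e g strict_mono_less_eq[OF f(1)] by simp
    then have "range (\<lambda>q. inv_into L e (f q)) \<subseteq> L \<and>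
        (\<forall>x y. x \<le> y \<longleftrightarrow> (inv_into L e (f x), inv_into L e (f y)) \<in> r)" using g(1) by auto
    from exI[of "\<lambda>g. range g \<subseteq> L \<and> (\<forall>x y. x \<le> y \<longleftrightarrow> (g x, g y) \<in> r)", OF this] show False
      using assms(3) unfolding scattered_on_def by (rule notE[rotated])
  qed
  define B where "B n = (\<Inter>m\<le>n. p m)" for n
  have B_Suc: "B (Suc n) = B n \<inter> p (Suc n)" for n by (auto simp: B_def atMost_Suc)
  have BL: "B n \<subseteq> L" for n using sub p by (fastforce simp: B_def)
  have below: "\<exists>D\<in>copies L r. D \<subseteq> C \<inter> B n" if "C \<in> copies L r" "C \<subseteq> p n" for C n
    using that
  proof (induction n arbitrary: C)
    case 0
    then show ?case by (intro bexI[of _ C]) (auto simp: B_def)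
  next
    case (Suc n)
    have "\<forall>C\<in>copies L r. C \<subseteq> p (Suc n) \<longrightarrow> (\<exists>D\<in>copies L r. D \<subseteq> C \<inter> p n)"
      using dec by (simp add: sep_mod_def)
    then obtain D where D: "D \<in> copies L r" "D \<subseteq> C \<inter> p n" using Suc.prems by blast
    then obtain E where "E \<in> copies L r" "E \<subseteq> D \<inter> B n" using Suc.IH[of D] by blast
    then show ?case using D Suc.prems by (intro bexI[of _ E]) (auto simp: B_Suc)
  qed
  have embB: "emb (e ` L) (e ` B n)" for n
  proof -
    have "\<exists>D\<in>copies L r. D \<subseteq> p n \<inter> B n" by (rule below) (use p in auto)
    then have "\<exists>D\<in>copies L r. D \<subseteq> B n" by blast
    then show ?thesis by (simp only: copy[OF BL])
  qed
  have "decseq (\<lambda>n. e ` B n)" unfolding decseq_Suc_iff B_Suc by blast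
  then have "\<exists>q\<subseteq>e ` L. emb (e ` L) q \<and> (\<forall>n C. C \<subseteq> q \<and> emb (e ` L) C \<longrightarrow> emb (e ` L) (C \<inter> e ` B n))"
    using assms(2) BL embB by (intro pseudo_intersection[OF _ scat]) auto
  then obtain q where "q \<subseteq> e ` L \<and> emb (e ` L) q \<and>
    (\<forall>n C. C \<subseteq> q \<and> emb (e ` L) C \<longrightarrow> emb (e ` L) (C \<inter> e ` B n))" ..
  then have q: "q \<subseteq> e ` L" "emb (e ` L) q"
    "\<And>n C. C \<subseteq> q \<Longrightarrow> emb (e ` L) C \<Longrightarrow> emb (e ` L) (C \<inter> e ` B n)" by simp_all
  obtain q' where q': "q' \<subseteq> L" "q = e ` q'" using q(1) by (meson subset_imageE)
  have "\<exists>D\<in>copies L r. D \<subseteq> q'" unfolding copy[OF q'(1)] using q(2) q'(2) by simp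
  then obtain Q where Q: "Q \<in> copies L r" "Q \<subseteq> q'" ..
  have "(Q, p n) \<in> sep_mod L r" for n
    unfolding sep_mod_def
  proof (clarsimp simp: Q p)
    fix C assume C: "C \<in> copies L r" "C \<subseteq> Q"
    have "emb (e ` L) (e ` C)" using copy[OF sub[OF C(1)]] C(1) by auto
    moreover have "e ` C \<subseteq> q" using q'(2) Q(2) C(2) by blast
    ultimately have "emb (e ` L) (e ` C \<inter> e ` B n)" using q(3) by simp
    then have "emb (e ` L) (e ` (C \<inter> B n))"
      using inj_on_image_Int[OF inj sub[OF C(1)] BL] by simp
    moreover have "C \<inter> B n \<subseteq> L" using BL by blast
    ultimately obtain D where "D \<in> copies L r" "D \<subseteq> C \<inter> B n" using copy[of "C \<inter> B n"] by auto
    then show "\<exists>D\<in>copies L r. D \<subseteq> C \<and> D \<subseteq> p n" by (auto simp: B_def)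
  qed
  then show "\<exists>q\<in>copies L r. \<forall>n. (q, p n) \<in> sep_mod L r" using Q(1) by blast
qed

end
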